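(* Let $K$ be a field and let $I\subset S=K[x_1,x_2,x_3]$ be a monomial ideal. (a) If $g(I)=1$ then $\operatorname{sdepth}(S/I)=2$. If $g(I)=2$ then $\operatorname{sdepth}(S/I)=1$. (b) If $g(I)\geq 3$ and $c(I)=2$ then $\operatorname{sdepth}(S/I)=1$. (c) If $g(I)=3$ and $c(I)=3$, then $\operatorname{sdepth}(S/I)=\operatorname{sdepth}(S/I')$, and $I'$ satisfies $g(I')=3$, $c(I')=3$ and, after a permutation of the variables, one of the following: (1) $\sqrt{I'}\supseteq(x_1,x_2)$; (2) $\sqrt{I'}=(x_1,x_2x_3)$ and $I'=(x_1^{a_1},x_2^{b_1}x_3^{c_1},x_1^{a_2}x_2^{b_2}x_3^{c_2})$ for some nonnegative integers $a_1,a_2,b_1,b_2,c_1,c_2$; (3) $\sqrt{I'}=(x_1x_2,x_1x_3,x_2x_3)$ and $I'=(x_1^{a_1}x_2^{b_1},x_1^{a_2}x_3^{c_1},x_2^{b_2}x_3^{c_2})$ for some positive integers $a_1,a_2,b_1,b_2,c_1,c_2$. (d) Suppose $m:=g(I)>3$ and $c(I)=3$, and write $G(I)=\{u_1,\ldots,u_m\}$. For every subset $\sigma=\{\sigma(1),\sigma(2),\sigma(3)\}\subset\{1,\ldots,m\}$ with $|\sigma|=3$ let $I_\sigma=(u_{\sigma(1)},u_{\sigma(2)},u_{\sigma(3)})$. If $\operatorname{sdepth}(S/I_\sigma)=1$ for all $\sigma$, then $\operatorname{sdepth}(S/I)=1$. Otherwise, if $I\neq(I:(x_1,x_2,x_3))$,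 then $\operatorname{sdepth}(S/I)=0$.
   Context: For a monomial ideal $I$: $G(I)$ is the set of minimal monomial generators of $I$; $g(I)=|G(I)|$; $v=\gcd(u\mid u\in G(I))$; $I'=(I:v)$, so $I=vI'$; $\operatorname{supp}(I)$ is the set of variables dividing some element of $G(I)$; $c(I)=|\operatorname{supp}(I')|$. For monomial ideals $J\subset I\subset S=K[x_1,\ldots,x_n]$ with $I/J\neq0$, a Stanley decomposition of $I/J$ is a decomposition $\mathcal D:\ I/J=\bigoplus_{i=1}^r u_iK[Z_i]$ as a $K$-vector space, where $u_i\in S$ are monomials and $Z_i\subset\{x_1,\ldots,x_n\}$; here $I/J$ is identified with the $K$-span of the monomials in $I\setminus J$, and $u_iK[Z_i]$ is the $K$-span of the monomials $u_iw$ with $w$ a monomial in the variables of $Z_i$. Put $\operatorname{sdepth}(\mathcal D)=\min_i|Z_i|$, and let $\operatorname{sdepth}(I/J)$ be the maximum of $\operatorname{sdepth}(\mathcal D)$ over all Stanley decompositions of $I/J$. In particular $\operatorname{sdepth}(S/I)$ is considered for $I\neq S$. *)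

theory Defs
  imports Complex_Main "HOL-Library.Poly_Mapping" "HOL-Library.Numeral_Type"
begin

section \<open>Polynomials, monomials, ideals\<close>

text \<open>
  Polynomials over \<open>'k\<close> in variables indexed by \<open>'v\<close>: finitely supported maps from exponent vectors
  to coefficients, with the convolution product of \<open>HOL-Library.Poly_Mapping\<close>. The ring
  $K[x_1,\ldots,x_n]$ is the case of an index type with $n$ elements; $K[x_1,x_2,x_3]$ uses the
  numeral type \<open>3\<close>, whose elements are \<open>1\<close>, \<open>2\<close> and \<open>3\<close> (which equals \<open>0\<close>).
  Throughout, a variable is identified with its index.
\<close>

type_synonym ('v, 'k) mpoly = "('v \<Rightarrow>\<^sub>0 nat) \<Rightarrow>\<^sub>0 'k"

definition monom :: "('v \<Rightarrow>\<^sub>0 nat) \<Rightarrow> ('v, 'k::field) mpoly" where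
  "monom a = Poly_Mapping.single a 1"

definition var :: "'v \<Rightarrow> ('v, 'k::field) mpoly" where
  "var i = monom (Poly_Mapping.single i 1)"

definition monomials :: "('v, 'k::field) mpoly set" where
  "monomials = range monom"

definition monomials_in :: "'v set \<Rightarrow> ('v, 'k::field) mpoly set" where
  "monomials_in Z = {monom a | a. Poly_Mapping.keys a \<subseteq> Z}"

text \<open>The ideals of a commutative ring are its submodules over itself.\<close>

abbreviation ideal_gen :: "'a::comm_ring_1 set \<Rightarrow> 'a set" where
  "ideal_gen \<equiv> module.span (*)"

lemma module_times: "module ((*) :: 'a::comm_ring_1 \<Rightarrow> 'a \<Rightarrow> 'a)"
  by unfold_locales (simp_all add: algebra_simps)

definition colon :: "'a::comm_ring_1 set \<Rightarrow> 'a set \<Rightarrow> 'a set" where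
  "colon I A = {f. \<forall>a\<in>A. f * a \<in> I}"

definition radical :: "'a::comm_ring_1 set \<Rightarrow> 'a set" where
  "radical I = {f. \<exists>k\<ge>1. f ^ k \<in> I}"

definition monomial_ideal :: "('v, 'k::field) mpoly set \<Rightarrow> bool" where
  "monomial_ideal I \<longleftrightarrow> (\<exists>M\<subseteq>monomials. I = ideal_gen M)"


section \<open>Invariants of a monomial ideal\<close>

text \<open>
  $G(I)$: the monomials of $I$ that are minimal with respect to divisibility. That this is the unique
  minimal set of monomial generators is shown below.
\<close>

definition mingens :: "('v, 'k::field) mpoly set \<Rightarrow> ('v, 'k) mpoly set" where
  "mingens I = {u \<in> monomials \<inter> I. \<forall>w \<in> monomials \<inter> I. w dvd u \<longrightarrow> w = u}"

definition num_mingens :: "('v, 'k::field) mpoly set \<Rightarrow> nat" where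
  "num_mingens I = card (mingens I)"

text \<open>
  The gcd of a nonempty set of monomials, taken in the monoid of monomials; that is, normalised to be
  a monomial.
\<close>

definition gcd_monomials :: "('v, 'k::field) mpoly set \<Rightarrow> ('v, 'k) mpoly" where
  "gcd_monomials U = (THE v. v \<in> monomials \<and> (\<forall>u\<in>U. v dvd u) \<and>
     (\<forall>w\<in>monomials. (\<forall>u\<in>U. w dvd u) \<longrightarrow> w dvd v))"

text \<open>$I' = (I : v)$ with $v = \gcd(u \mid u \in G(I))$.\<close>

definition gcd_free_part :: "('v, 'k::field) mpoly set \<Rightarrow> ('v, 'k) mpoly set" where
  "gcd_free_part I = colon I {gcd_monomials (mingens I)}"

definition supp :: "('v, 'k::field) mpoly set \<Rightarrow> 'v set" where
  "supp I = {i. \<exists>u\<in>mingens I. var i dvd u}"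

text \<open>$c(I) = |\mathrm{supp}(I')|$\<close>

definition c_inv :: "('v, 'k::field) mpoly set \<Rightarrow> nat" where
  "c_inv I = card (supp (gcd_free_part I))"


section \<open>Stanley decompositions and Stanley depth\<close>

abbreviation kspan :: "('v, 'k::field) mpoly set \<Rightarrow> ('v, 'k) mpoly set" where
  "kspan \<equiv> module.span (\<lambda>c f. Poly_Mapping.single 0 c * f)"

lemma vector_space_mpoly:
  "vector_space (\<lambda>c (f :: ('v, 'k::field) mpoly). Poly_Mapping.single 0 c * f)"
  by unfold_locales (simp_all add: distrib_left distrib_right single_add mult_single flip: mult.assoc)

definition internal_direct_sum :: "'i set \<Rightarrow> ('i \<Rightarrow> 'a::comm_monoid_add set) \<Rightarrow> 'a set \<Rightarrow> bool" where
  "internal_direct_sum A W V \<longleftrightarrow>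
     V = {(\<Sum>i\<in>A. g i) | g. \<forall>i\<in>A. g i \<in> W i} \<and>
     (\<forall>g. (\<forall>i\<in>A. g i \<in> W i) \<and> (\<Sum>i\<in>A. g i) = 0 \<longrightarrow> (\<forall>i\<in>A. g i = 0))"

text \<open>$uK[Z]$\<close>

definition stanley_space :: "('v, 'k::field) mpoly \<Rightarrow> 'v set \<Rightarrow> ('v, 'k) mpoly set" where
  "stanley_space u Z = kspan {u * w | w. w \<in> monomials_in Z}"

text \<open>
  A decomposition of $I/J$ is a list of pairs $(u_i, Z_i)$; $I/J$ is identified with the span of the
  monomials in $I \setminus J$.
\<close>

definition stanley_decomposition ::
  "('v, 'k::field) mpoly set \<Rightarrow> ('v, 'k) mpoly set \<Rightarrow> (('v, 'k) mpoly \<times> 'v set) list \<Rightarrow> bool" where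
  "stanley_decomposition I J D \<longleftrightarrow>
     fst ` set D \<subseteq> monomials \<and>
     internal_direct_sum {..<length D} (\<lambda>i. stanley_space (fst (D ! i)) (snd (D ! i)))
       (kspan (monomials \<inter> (I - J)))"

definition sdepth_decomp :: "(('v, 'k::field) mpoly \<times> 'v set) list \<Rightarrow> nat" where
  "sdepth_decomp D = Min ((\<lambda>(u, Z). card Z) ` set D)"

text \<open>
  The Stanley depth of $I/J$ for monomial ideals $J \subset I$, only meaningful if $I/J \neq 0$ (so that
  every decomposition is nonempty) and the set of variables is finite. $S/I$ is the case of \<open>UNIV\<close> and
  \<open>I\<close>.
\<close>

definition sdepth :: "('v::finite, 'k::field) mpoly set \<Rightarrow> ('v, 'k) mpoly set \<Rightarrow> nat" where
  "sdepth I J = Max {sdepth_decomp D | D. stanley_decomposition I J D}"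


section \<open>Well-definedness of the minimal generators and of the gcd\<close>

lemma monom_mult: "monom a * monom b = (monom (a + b) :: ('v, 'k::field) mpoly)"
  by (simp add: monom_def mult_single)

lemma monom_eq_iff [simp]: "(monom a :: ('v, 'k::field) mpoly) = monom b \<longleftrightarrow> a = b"
  by (metis inj_single keys_single monom_def singleton_inject zero_neq_one)

lemma monom_in_monomials [simp]: "monom a \<in> monomials"
  by (simp add: monomials_def)

lemma monom_dvd_iff:
  "(monom a :: ('v, 'k::field) mpoly) dvd monom b \<longleftrightarrow>
   (\<forall>i. Poly_Mapping.lookup a i \<le> Poly_Mapping.lookup b i)"
proof
  assume "(monom a :: ('v, 'k) mpoly) dvd monom b"
  then obtain q :: "('v, 'k) mpoly" where q: "monom b = monom a * q"
    by (elim dvdE)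
  have "b \<in> Poly_Mapping.keys (monom a * q)"
    unfolding q[symmetric] by (simp add: monom_def)
  then obtain x y where "b = x + y" "x \<in> Poly_Mapping.keys (monom a :: ('v, 'k) mpoly)"
    using keys_mult[of "monom a" q] by blast
  then show "\<forall>i. Poly_Mapping.lookup a i \<le> Poly_Mapping.lookup b i"
    by (simp add: monom_def lookup_add)
next
  assume le: "\<forall>i. Poly_Mapping.lookup a i \<le> Poly_Mapping.lookup b i"
  have "a + (b - a) = b"
    using le by (intro poly_mapping_eqI) (simp add: lookup_add lookup_minus)
  then show "(monom a :: ('v, 'k) mpoly) dvd monom b"
    by (metis dvd_triv_left monom_mult)
qed

lemma monom_dvd_antisym:
  "u \<in> monomials \<Longrightarrow> w \<in> monomials \<Longrightarrow> u dvd w \<Longrightarrow> w dvd u \<Longrightarrow> u = w"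
  by (auto simp: monomials_def monom_dvd_iff)
    (metis antisym poly_mapping_eqI)

lemma monomial_in_ideal_gen:
  fixes M :: "('v, 'k::field) mpoly set"
  assumes "M \<subseteq> monomials" "w \<in> monomials" "w \<in> ideal_gen M"
  shows "\<exists>u\<in>M. u dvd w"
proof -
  interpret module "(*) :: ('v, 'k) mpoly \<Rightarrow> _" by (rule module_times)
  define T where "T = {f :: ('v, 'k) mpoly. \<forall>k\<in>Poly_Mapping.keys f. \<exists>u\<in>M. u dvd monom k}"
  have "subspace T"
  proof (rule subspaceI)
    show "0 \<in> T" by (simp add: T_def)
  next
    fix f g assume "f \<in> T" "g \<in> T"
    then show "f + g \<in> T"
      using Poly_Mapping.keys_add[of f g] by (auto simp: T_def)
  next
    fix c f assume f: "f \<in> T"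
    show "c * f \<in> T"
      unfolding T_def
    proof (intro CollectI ballI)
      fix k assume "k \<in> Poly_Mapping.keys (c * f)"
      then obtain x y where k: "k = x + y" "y \<in> Poly_Mapping.keys f"
        using keys_mult[of c f] by blast
      then obtain u where u: "u \<in> M" "u dvd monom y"
        using f by (auto simp: T_def)
      have "monom k = monom x * (monom y :: ('v, 'k) mpoly)"
        by (simp add: k monom_mult)
      then show "\<exists>u\<in>M. u dvd monom k"
        using u by (metis dvd_mult)
    qed
  qed
  moreover have "M \<subseteq> T"
  proof
    fix u assume u: "u \<in> M"
    then obtain a where "u = monom a" using assms(1) by (auto simp: monomials_def)
    then show "u \<in> T" using u by (auto simp: T_def monom_def intro: bexI[of _ u])
  qed
  ultimately have "w \<in> T"
    using assms(3) span_minimal by blast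
  then show ?thesis
    using assms(2) by (auto simp: T_def monomials_def monom_def)
qed

lemma ex_mingens_dvd:
  fixes I :: "('v::finite, 'k::field) mpoly set"
  assumes "w \<in> monomials" "w \<in> I"
  shows "\<exists>u\<in>mingens I. u dvd w"
proof -
  define deg where "deg a = (\<Sum>i\<in>UNIV. Poly_Mapping.lookup a i)" for a :: "'v \<Rightarrow>\<^sub>0 nat"
  obtain b where b: "w = monom b" using assms(1) by (auto simp: monomials_def)
  have "\<exists>u\<in>mingens I. u dvd monom b" if "monom b \<in> I" for b
    using that
  proof (induction "deg b" arbitrary: b rule: less_induct)
    case less
    show ?case
    proof (cases "(monom b :: ('v, 'k) mpoly) \<in> mingens I")
      case False
      then obtain a where a: "(monom a :: ('v, 'k) mpoly) \<in> I"
          "(monom a :: ('v, 'k) mpoly) dvd monom b" "a \<noteq> b"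
        using less.prems by (auto simp: mingens_def monomials_def)
      have le: "\<forall>i. Poly_Mapping.lookup a i \<le> Poly_Mapping.lookup b i"
        using a(2) by (simp add: monom_dvd_iff)
      moreover obtain j where "Poly_Mapping.lookup a j \<noteq> Poly_Mapping.lookup b j"
        using a(3) by (meson poly_mapping_eqI)
      ultimately have "deg a < deg b"
        unfolding deg_def by (intro sum_strict_mono_ex1) (auto simp: nat_less_le)
      then show ?thesis
        using less.hyps[of a] a by (meson dvd_trans)
    next
      case True
      then show ?thesis by (meson dvd_refl)
    qed
  qed
  then show ?thesis using assms(2) b by blast
qed

theorem ideal_gen_mingens:
  fixes I :: "('v::finite, 'k::field) mpoly set"
  assumes "monomial_ideal I"
  shows "ideal_gen (mingens I) = I"
proof -
  interpret module "(*) :: ('v, 'k) mpoly \<Rightarrow> _" by (rule module_times)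
  obtain M where M: "M \<subseteq> monomials" "I = span M"
    using assms by (auto simp: monomial_ideal_def)
  have "w \<in> span (mingens I)" if w: "w \<in> M" for w
  proof -
    obtain u q where u: "u \<in> mingens I" and q: "w = u * q"
      using ex_mingens_dvd[of w I] w M span_base by (blast elim: dvdE)
    have "q * u \<in> span (mingens I)"
      by (intro span_scale span_base u)
    then show ?thesis
      by (simp add: q mult.commute)
  qed
  then have "span M \<subseteq> span (mingens I)"
    by (intro span_minimal) auto
  moreover have "span (mingens I) \<subseteq> span M"
    by (intro span_minimal) (auto simp: mingens_def M(2))
  ultimately show ?thesis using M(2) by blast
qed

theorem mingens_least:
  fixes M :: "('v, 'k::field) mpoly set"
  assumes "M \<subseteq> monomials"
  shows "mingens (ideal_gen M) \<subseteq> M"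
proof
  fix u assume u: "u \<in> mingens (ideal_gen M)"
  interpret module "(*) :: ('v, 'k) mpoly \<Rightarrow> _" by (rule module_times)
  obtain w where w: "w \<in> M" "w dvd u"
    using monomial_in_ideal_gen[OF assms] u by (auto simp: mingens_def)
  then have "w = u"
    using u assms span_base[of w M] by (auto simp: mingens_def)
  with w show "u \<in> M" by simp
qed

theorem gcd_monomials_unique_ex:
  fixes U :: "('v, 'k::field) mpoly set"
  assumes "U \<subseteq> monomials" "U \<noteq> {}"
  shows "\<exists>!v. v \<in> monomials \<and> (\<forall>u\<in>U. v dvd u) \<and>
           (\<forall>w\<in>monomials. (\<forall>u\<in>U. w dvd u) \<longrightarrow> w dvd v)"
proof -
  define E where "E = {a. (monom a :: ('v, 'k) mpoly) \<in> U}"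
  have U: "U = monom ` E"
    using assms(1) by (auto simp: E_def monomials_def)
  then obtain e where e: "e \<in> E" using assms(2) by auto
  define h where "h i = (LEAST n. n \<in> (\<lambda>a. Poly_Mapping.lookup a i) ` E)" for i
  have h_le: "h i \<le> Poly_Mapping.lookup a i" if "a \<in> E" for a i
    unfolding h_def using that by (intro Least_le) auto
  have h_in: "\<exists>a\<in>E. h i = Poly_Mapping.lookup a i" for i
    using LeastI[of "\<lambda>n. n \<in> (\<lambda>a. Poly_Mapping.lookup a i) ` E" "Poly_Mapping.lookup e i"] e
    unfolding h_def[symmetric] by auto
  have "{i. h i \<noteq> 0} \<subseteq> Poly_Mapping.keys e"
  proof
    fix i assume "i \<in> {i. h i \<noteq> 0}"
    then show "i \<in> Poly_Mapping.keys e"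
      using h_le[OF e, of i] by (simp add: in_keys_iff)
  qed
  then have fin: "finite {i. h i \<noteq> 0}" by (rule finite_subset) simp
  define v :: "('v, 'k) mpoly" where "v = monom (Abs_poly_mapping h)"
  have lookup_h: "Poly_Mapping.lookup (Abs_poly_mapping h) = h"
    using fin by simp
  have greatest: "w dvd v" if "w \<in> monomials" "\<forall>u\<in>U. w dvd u" for w
  proof -
    obtain b where b: "w = monom b" using \<open>w \<in> monomials\<close> by (auto simp: monomials_def)
    have "\<forall>a\<in>E. \<forall>i. Poly_Mapping.lookup b i \<le> Poly_Mapping.lookup a i"
      using that(2) by (simp add: U b monom_dvd_iff)
    then have "Poly_Mapping.lookup b i \<le> h i" for i
      using h_in[of i] by auto
    then show ?thesis by (simp add: v_def b monom_dvd_iff lookup_h)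
  qed
  have v: "v \<in> monomials" "\<forall>u\<in>U. v dvd u"
    using h_le by (auto simp: v_def U monom_dvd_iff lookup_h)
  show ?thesis
  proof (rule ex1I[of _ v])
    fix v' assume "v' \<in> monomials \<and> (\<forall>u\<in>U. v' dvd u) \<and>
      (\<forall>w\<in>monomials. (\<forall>u\<in>U. w dvd u) \<longrightarrow> w dvd v')"
    then show "v' = v"
      using v greatest by (intro monom_dvd_antisym) auto
  qed (use v greatest in blast)
qed

end

theory Submission
  imports Defs "HOL-Library.FuncSet"
begin

text \<open>
  A Stanley decomposition of $S/I$ is a partition of the exponent vectors outside $I$ into finitely
  many blocks $c + \<nat>^Z$. Let \<open>G\<close> be the set of exponents of the minimal generators. A block without
  elements of $I$ that contains the exponent of the gcd of $G(I)$ has $|Z| \le n - 2$ if $g(I) \ge 2$,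
  because each exponent of the gcd is attained by a generator. A socle element, that is, $a \notin I$
  with $a + e_i \in I$ for all $i$, lies only in the block $\{a\}$; conversely, if there is no socle
  element, the complement can be partitioned into blocks with $Z \neq \emptyset$. So for $n = 3$ and
  $g(I) \ge 2$ the Stanley depth is $1$ or $0$ according to whether the socle vanishes. A socle element
  $a$ comes with generators $u_i$ such that $u_i$ has exponent $a_i + 1$ at $i$ and at most $a_j$ at
  $j \neq i$; these $n$ distinct generators alone have $a$ as a socle element.
\<close>

section \<open>Partitions of the complement of an up-set\<close>

text \<open>The hard point is that, without socle elements, every block can be given a direction.
  Let \<open>N\<close> exceed all exponents of the generators. Beyond \<open>N\<close> the size of
  an exponent does not affect membership in \<open>I\<close>, so points with a coordinate at least
  \<open>N\<close> fall into finitely many blocks whose directions are those coordinates. The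
  remaining points lie in a finite cube and have to be absorbed into axis-parallel lines outside
  \<open>I\<close>, where lines chosen by different points must not cross. A linear order on the
  variables settles this: each point takes the least direction whose whole line avoids
  \<open>I\<close>. Along that direction the other candidates can only disappear, so the points
  choosing it form an upper ray of the line, which is a block. A point without any candidate has
  only finitely many multiples outside \<open>I\<close>, and a maximal one among them is a socle
  element.

  In (c), dividing by the gcd does not affect the existence of a socle element. The three shapes of
  \<open>I'\<close> arise from counting the variables that have a pure power among the
  generators.\<close>

definition block :: "('v \<Rightarrow> nat) \<Rightarrow> 'v set \<Rightarrow> ('v \<Rightarrow> nat) set" where
  "block c Z = {b. (\<forall>i\<in>Z. c i \<le> b i) \<and> (\<forall>i. i \<notin> Z \<longrightarrow> b i = c i)}"

definition block_partition :: "(('v \<Rightarrow> nat) \<times> 'v set) set \<Rightarrow> ('v \<Rightarrow> nat) set \<Rightarrow> bool" where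
  "block_partition P A \<longleftrightarrow> finite P \<and> A = (\<Union>p\<in>P. block (fst p) (snd p)) \<and>
     (\<forall>p\<in>P. \<forall>q\<in>P. p \<noteq> q \<longrightarrow> block (fst p) (snd p) \<inter> block (fst q) (snd q) = {})"

definition upset :: "('v \<Rightarrow> nat) set \<Rightarrow> ('v \<Rightarrow> nat) set" where
  "upset G = {b. \<exists>g\<in>G. g \<le> b}"

definition socle :: "('v \<Rightarrow> nat) set \<Rightarrow> ('v \<Rightarrow> nat) set" where
  "socle E = {a. a \<notin> E \<and> (\<forall>i. a(i := Suc (a i)) \<in> E)}"

lemma upset_mono: "a \<in> upset G \<Longrightarrow> a \<le> b \<Longrightarrow> b \<in> upset G"
  unfolding upset_def by (blast intro: order_trans)

text \<open>The fibres of a map are disjoint and cover its domain. A block partition thus amounts to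
  a labelling \<open>\<kappa>\<close> with finitely many values whose fibres are blocks;
  \<open>Q\<close> carries the property wanted of the directions.\<close>

lemma partition_by_fibres:
  assumes "finite (\<kappa> ` A)"
    and "\<And>a. a \<in> A \<Longrightarrow> \<exists>c Z. Q Z \<and> {b \<in> A. \<kappa> b = \<kappa> a} = block c Z"
  shows "\<exists>P. block_partition P A \<and> (\<forall>p\<in>P. Q (snd p))"
proof -
  have "\<forall>x\<in>\<kappa> ` A. \<exists>p. Q (snd p) \<and> {b \<in> A. \<kappa> b = x} = block (fst p) (snd p)"
    using assms(2) by fastforce
  then obtain F where F: "\<And>x. x \<in> \<kappa> ` A \<Longrightarrow> Q (snd (F x)) \<and> {b \<in> A. \<kappa> b = x} = block (fst (F x)) (snd (F x))"
    by metis
  have "block_partition (F ` \<kappa> ` A) A"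
    unfolding block_partition_def
  proof (intro conjI ballI impI)
    show "finite (F ` \<kappa> ` A)" using assms(1) by simp
    show "A = (\<Union>p\<in>F ` \<kappa> ` A. block (fst p) (snd p))"
    proof -
      have "(\<Union>p\<in>F ` \<kappa> ` A. block (fst p) (snd p)) = (\<Union>x\<in>\<kappa> ` A. {b \<in> A. \<kappa> b = x})"
        unfolding image_image by (intro SUP_cong refl) (use F in blast)
      also have "\<dots> = A" by blast
      finally show ?thesis by (rule sym)
    qed
  next
    fix p q assume "p \<in> F ` \<kappa> ` A" "q \<in> F ` \<kappa> ` A" "p \<noteq> q"
    obtain x where x: "x \<in> \<kappa> ` A" "p = F x" using \<open>p \<in> F ` \<kappa> ` A\<close> by (rule imageE)
    obtain y where y: "y \<in> \<kappa> ` A" "q = F y" using \<open>q \<in> F ` \<kappa> ` A\<close> by (rule imageE)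
    have "block (fst p) (snd p) = {b \<in> A. \<kappa> b = x}" "block (fst q) (snd q) = {b \<in> A. \<kappa> b = y}"
      using F[OF x(1)] F[OF y(1)] x(2) y(2) by simp_all
    moreover have "x \<noteq> y" using x(2) y(2) \<open>p \<noteq> q\<close> by blast
    ultimately show "block (fst p) (snd p) \<inter> block (fst q) (snd q) = {}" by auto
  qed
  then show ?thesis using F by (intro exI[of _ "F ` \<kappa> ` A"] conjI) auto
qed

lemma finite_bounded_functions: "finite {f :: 'v::finite \<Rightarrow> nat. \<forall>i. f i < N}"
proof -
  have "finite (\<Pi>\<^sub>E i\<in>(UNIV :: 'v set). {..<N})" by (intro finite_PiE) auto
  moreover have "(\<Pi>\<^sub>E i\<in>(UNIV :: 'v set). {..<N}) = {f. \<forall>i. f i < N}"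
    by (auto simp: PiE_def)
  ultimately show ?thesis by simp
qed

text \<open>A direction-free block is tolerated exactly when a socle element accounts for it. So the
  lemma serves twice: it gives positive depth when the socle is empty, and in general it shows that
  decompositions exist.\<close>

lemma partition_upset_compl:
  fixes G :: "('v::{finite, linorder} \<Rightarrow> nat) set"
  assumes "finite G"
  shows "\<exists>P. block_partition P (- upset G) \<and> (\<forall>p\<in>P. snd p = {} \<longrightarrow> socle (upset G) \<noteq> {})"
proof -
  define A where "A = - upset G"
  have "finite (\<Union>g\<in>G. range g)" using assms by simp
  then obtain N where "\<forall>n\<in>(\<Union>g\<in>G. range g). n < N"
    using finite_nat_set_iff_bounded by blast
  then have N: "g i < N" if "g \<in> G" for g i using that by blast
  have down: "a \<in> A" if "b \<in> A" "a \<le> b" for a b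
    using that upset_mono[of a G b] by (auto simp: A_def)
  \<comment> \<open>All exponents of generators are below \<open>N\<close>: raising a coordinate
    that is already at least \<open>N\<close> cannot make a further generator divide.\<close>
  have cut: "b \<in> A" if "a \<in> A" "\<And>i. b i \<le> a i \<or> N \<le> a i" for a b
  proof -
    have "g \<le> a" if g: "g \<in> G" "g \<le> b" for g
    proof (rule le_funI)
      fix i show "g i \<le> a i"
        using \<open>\<And>i. b i \<le> a i \<or> N \<le> a i\<close>[of i] N[OF g(1), of i] le_funD[OF g(2), of i] by linarith
    qed
    then show ?thesis using \<open>a \<in> A\<close> by (auto simp: A_def upset_def)
  qed
  define Z where "Z a = {i. N \<le> a i}" for a :: "'v \<Rightarrow> nat"
  define R where "R a = {i. \<forall>t. a(i := t) \<in> A}" for a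
  \<comment> \<open>\<open>T a\<close> is the set of directions of the block of \<open>a\<close>.\<close>
  define T where "T a = (if Z a \<noteq> {} then Z a else if R a \<noteq> {} then {Min (R a)} else {})" for a
  \<comment> \<open>The coordinates in free directions vary inside a block and are overwritten by 0.
    The others are below \<open>N\<close> because \<open>Z a\<close> is contained in
    \<open>T a\<close>, so only finitely many labels occur.\<close>
  define \<kappa> where "\<kappa> a = (T a, \<lambda>i. if i \<in> T a then 0 else a i)" for a
  have ZT: "Z a \<subseteq> T a" for a by (auto simp: T_def)
  have \<kappa>_eq: "\<kappa> b = \<kappa> a \<longleftrightarrow> T b = T a \<and> (\<forall>i. i \<notin> T a \<longrightarrow> b i = a i)" for a b
    by (auto simp: \<kappa>_def fun_eq_iff)
  have "\<kappa> ` A \<subseteq> UNIV \<times> {f. \<forall>i. f i < Suc N}"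
  proof -
    have "(if i \<in> T a then 0 else a i) < Suc N" for a i
      using ZT[of a] by (cases "N \<le> a i") (auto simp: Z_def)
    then show ?thesis unfolding \<kappa>_def by blast
  qed
  then have fin: "finite (\<kappa> ` A)"
    by (rule finite_subset) (intro finite_cartesian_product finite_bounded_functions finite)
  have "\<exists>c W. (W = {} \<longrightarrow> socle (upset G) \<noteq> {}) \<and> {b \<in> A. \<kappa> b = \<kappa> a} = block c W" if a: "a \<in> A" for a
  proof -
    consider "T a = {}" | i where "T a = {i}" | "T a \<noteq> {}" "\<nexists>i. T a = {i}" by blast
    then show ?thesis
    proof cases
      case 1
      have Za: "Z a = {}" using 1 ZT[of a] by simp
      have Ra: "R a = {}" using 1 Za unfolding T_def by (simp split: if_split_asm)
      \<comment> \<open>A maximal element of \<open>X\<close> will be a socle element. It exists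
        because \<open>X\<close> is bounded: a coordinate at least \<open>N\<close> of some element
        of \<open>X\<close> would put a whole line through \<open>a\<close> into \<open>A\<close>,
        although \<open>R a\<close> is empty.\<close>
      define X where "X = {b \<in> A. a \<le> b}"
      have "b i < N" if b: "b \<in> X" for b i
      proof (rule ccontr)
        assume "\<not> b i < N"
        then have "a(i := t) \<in> A" for t
          by (intro cut[of b "a(i := t)"]) (use b in \<open>auto simp: X_def le_fun_def\<close>)
        then show False using Ra by (auto simp: R_def)
      qed
      then have "finite X"
        by (intro finite_subset[OF _ finite_bounded_functions[of N]]) auto
      moreover have "a \<in> X" using a by (simp add: X_def)
      ultimately obtain b where b: "b \<in> X" "\<And>c. c \<in> X \<Longrightarrow> b \<le> c \<Longrightarrow> b = c"
        using finite_has_maximal[of X] by blast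
      have "b(i := Suc (b i)) \<notin> A" for i
      proof
        assume A: "b(i := Suc (b i)) \<in> A"
        have le: "b \<le> b(i := Suc (b i))" by (simp add: le_fun_def)
        then have "b(i := Suc (b i)) \<in> X" using A b(1) by (auto simp: X_def)
        from b(2)[OF this le] have "b i = (b(i := Suc (b i))) i" by (rule fun_cong)
        then show False by simp
      qed
      then have "b \<in> socle (upset G)" using b(1) by (auto simp: socle_def X_def A_def)
      moreover have "{b \<in> A. \<kappa> b = \<kappa> a} = block a {}"
        using a 1 by (auto simp: \<kappa>_eq block_def fun_eq_iff[symmetric])
      ultimately show ?thesis by blast
    next
      case (2 i)
      have small: "\<not> N \<le> a j" if "j \<noteq> i" for j
        using 2 that ZT[of a] by (cases "N \<le> a j") (auto simp: Z_def)
      have line: "a(i := t) \<in> A" for t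
      proof (cases "Z a = {}")
        case True
        then have "R a \<noteq> {}" "i = Min (R a)"
          using 2 True unfolding T_def by (simp_all split: if_split_asm)
        then have "i \<in> R a" using Min_in[of "R a"] by simp
        then show ?thesis by (auto simp: R_def)
      next
        case False
        then have "N \<le> a i" using 2 by (auto simp: T_def Z_def)
        then show ?thesis by (intro cut[OF a]) auto
      qed
      \<comment> \<open>Shrinking the \<open>i\<close>-th exponent can only enlarge \<open>R\<close>, so \<open>i\<close> stays minimal when it grows.\<close>
      have up: "T (a(i := s)) = {i}" if t: "T (a(i := t)) = {i}" "t \<le> s" for s t
      proof (cases "N \<le> s")
        case True
        then have "Z (a(i := s)) = {i}" using small by (auto simp: Z_def)
        then show ?thesis by (simp add: T_def)
      next
        case False
        then have Zs: "Z (a(i := s)) = {}" and Zt: "Z (a(i := t)) = {}"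
          using small t(2) by (auto simp: Z_def)
        have Rs: "i \<in> R (a(i := s))" using line by (simp add: R_def)
        have Rt: "i = Min (R (a(i := t)))"
          using t(1) Zt unfolding T_def by (simp split: if_split_asm)
        have "R (a(i := s)) \<subseteq> R (a(i := t))"
        proof
          fix j assume "j \<in> R (a(i := s))"
          then have "(a(i := s))(j := r) \<in> A" for r by (simp add: R_def)
          then have "(a(i := t))(j := r) \<in> A" for r
            by (rule down) (use t(2) in \<open>auto simp: le_fun_def\<close>)
          then show "j \<in> R (a(i := t))" by (simp add: R_def)
        qed
        then have "i \<le> j" if "j \<in> R (a(i := s))" for j
          using that by (subst Rt) (auto intro: Min_le)
        then have "Min (R (a(i := s))) = i"
          using Rs by (intro Min_eqI) auto
        then show ?thesis using Zs Rs by (auto simp: T_def)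
      qed
      \<comment> \<open>By \<open>up\<close>, the points of this line that choose \<open>i\<close>
        form a ray; \<open>t0\<close> is its starting point and hence the corner of the
        block.\<close>
      define t0 where "t0 = (LEAST t. T (a(i := t)) = {i})"
      have "T (a(i := a i)) = {i}" using 2 by simp
      then have t0: "T (a(i := t0)) = {i}"
        unfolding t0_def by (rule LeastI)
      have T_iff: "T (a(i := t)) = {i} \<longleftrightarrow> t0 \<le> t" for t
        using up[OF t0, of t] Least_le[of "\<lambda>t. T (a(i := t)) = {i}" t, folded t0_def] by (rule iffI[rotated])
      have "{b \<in> A. \<kappa> b = \<kappa> a} = block (a(i := t0)) {i}"
      proof (rule set_eqI)
        fix b
        have "b \<in> A \<and> T b = {i} \<and> (\<forall>j. j \<noteq> i \<longrightarrow> b j = a j) \<longleftrightarrow>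
              t0 \<le> b i \<and> (\<forall>j. j \<noteq> i \<longrightarrow> b j = a j)"
        proof (cases "\<forall>j. j \<noteq> i \<longrightarrow> b j = a j")
          case True
          then have "b = a(i := b i)" by auto
          then show ?thesis using line T_iff True by metis
        qed blast
        then show "b \<in> {b \<in> A. \<kappa> b = \<kappa> a} \<longleftrightarrow> b \<in> block (a(i := t0)) {i}"
          by (auto simp: \<kappa>_eq 2 block_def)
      qed
      then show ?thesis by blast
    next
      case 3
      \<comment> \<open>Two or more directions can only come from \<open>Z\<close>, since the other
        branches of \<open>T\<close> give at most one.\<close>
      have TZ: "Z b = T b" if "T b = T a" for b
        using 3 that unfolding T_def[of b] by (metis (full_types))
      have "{b \<in> A. \<kappa> b = \<kappa> a} = block (\<lambda>i. if i \<in> Z a then N else a i) (Z a)"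
      proof (intro equalityI subsetI)
        fix b assume b: "b \<in> {b \<in> A. \<kappa> b = \<kappa> a}"
        then have T: "T b = T a" by (simp add: \<kappa>_eq)
        show "b \<in> block (\<lambda>i. if i \<in> Z a then N else a i) (Z a)"
          using b TZ[OF T] TZ[OF refl] by (auto simp: block_def \<kappa>_eq Z_def)
      next
        fix b assume b: "b \<in> block (\<lambda>i. if i \<in> Z a then N else a i) (Z a)"
        then have Zb: "Z b = Z a" by (auto simp: block_def Z_def)
        have "T b = T a" using Zb TZ[OF refl] 3(1) unfolding T_def[of b] by simp
        moreover have "b \<in> A"
          by (rule cut[OF a]) (use b in \<open>auto simp: block_def Z_def\<close>)
        ultimately show "b \<in> {b \<in> A. \<kappa> b = \<kappa> a}"
          using b TZ[of a] by (auto simp: \<kappa>_eq block_def)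
      qed
      then show ?thesis using 3(1) TZ[of a] by blast
    qed
  qed
  then show ?thesis
    using partition_by_fibres[OF fin, of "\<lambda>W. W = {} \<longrightarrow> socle (upset G) \<noteq> {}"] by (simp add: A_def)
qed

text \<open>A monomial lies outside a principal ideal exactly if some exponent is too small. Sorting
  by the first such variable and by its exponent leaves the other variables free, apart from the
  lower bounds \<open>g j\<close> at the earlier ones.\<close>

lemma partition_principal_compl:
  fixes g :: "'v::{finite, linorder} \<Rightarrow> nat"
  shows "\<exists>P. block_partition P (- upset {g}) \<and> (\<forall>p\<in>P. card (snd p) = CARD('v) - 1)"
proof -
  define m where "m a = Min {i. a i < g i}" for a
  define \<kappa> where "\<kappa> a = (m a, a (m a))" for a
  have A: "a \<in> - upset {g} \<longleftrightarrow> {i. a i < g i} \<noteq> {}" for a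
    by (auto simp: upset_def le_fun_def not_le)
  have m: "a (m a) < g (m a)" "\<And>j. j < m a \<Longrightarrow> g j \<le> a j" if "a \<in> - upset {g}" for a
    using that A Min_in[of "{i. a i < g i}"] Min_le[of "{i. a i < g i}"]
    by (auto simp: m_def not_less[symmetric])
  have m_eq: "a \<in> - upset {g} \<and> m a = i" if "a i < g i" "\<And>j. j < i \<Longrightarrow> g j \<le> a j" for a i
  proof -
    have "m a = i" unfolding m_def
      using that by (intro Min_eqI) (auto simp: not_less[symmetric])
    then show ?thesis using that A by blast
  qed
  have "\<kappa> ` (- upset {g}) \<subseteq> (SIGMA i:UNIV. {..<g i})"
    using m by (auto simp: \<kappa>_def)
  then have fin: "finite (\<kappa> ` (- upset {g}))" by (rule finite_subset) auto
  have "\<exists>c Z. card Z = CARD('v) - 1 \<and> {b \<in> - upset {g}. \<kappa> b = \<kappa> a} = block c Z"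
    if a: "a \<in> - upset {g}" for a
  proof -
    define i where "i = m a"
    define c where "c j = (if j < i then g j else if j = i then a i else 0)" for j
    have "{b \<in> - upset {g}. \<kappa> b = \<kappa> a} = block c (- {i})"
    proof (intro equalityI subsetI)
      fix b assume "b \<in> {b \<in> - upset {g}. \<kappa> b = \<kappa> a}"
      then show "b \<in> block c (- {i})"
        using m(2)[of b] by (auto simp: block_def c_def \<kappa>_def i_def)
    next
      fix b assume b: "b \<in> block c (- {i})"
      then have bi: "b i = a i" by (auto simp: block_def c_def)
      have "b i < g i" using m(1)[OF a] bi by (simp add: i_def)
      moreover have "g j \<le> b j" if "j < i" for j
        using b that by (auto simp: block_def c_def dest!: bspec[of _ _ j])
      ultimately show "b \<in> {b \<in> - upset {g}. \<kappa> b = \<kappa> a}"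
        using m_eq[of b i] bi by (auto simp: \<kappa>_def i_def)
    qed
    moreover have "card (- {i}) = CARD('v) - 1"
      by (simp add: Compl_eq_Diff_UNIV)
    ultimately show ?thesis by blast
  qed
  then show ?thesis by (rule partition_by_fibres[OF fin])
qed

text \<open>If \<open>Z\<close> missed at most the index \<open>i\<close>, take a generator
  \<open>g\<close> with \<open>g i = v i\<close> and raise \<open>v\<close> to the maximum of
  \<open>v\<close> and \<open>g\<close> away from \<open>i\<close>. The result stays in the block
  and is divisible by \<open>g\<close>. So at least two directions are missing.\<close>

lemma card_block_directions_le:
  fixes G :: "('v::finite \<Rightarrow> nat) set"
  assumes v: "v \<in> block c Z" and disj: "block c Z \<inter> upset G = {}"
    and G: "finite G" "G \<noteq> {}" and vG: "\<And>i. \<exists>g\<in>G. g i = v i"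
  shows "card Z \<le> CARD('v) - 2"
proof -
  have "Z \<noteq> - {i}" "Z \<noteq> UNIV" for i
  proof -
    have no: "\<not> - {i} \<subseteq> Z" for i
    proof
      assume Z: "- {i} \<subseteq> Z"
      obtain g where g: "g \<in> G" "g i = v i" using vG by blast
      have "(\<lambda>j. if j = i then v j else max (v j) (g j)) \<in> block c Z"
        using v Z by (auto simp: block_def)
      moreover have "g \<le> (\<lambda>j. if j = i then v j else max (v j) (g j))"
        using g by (auto simp: le_fun_def)
      ultimately show False using disj g(1) by (auto simp: upset_def)
    qed
    from no[of i] show "Z \<noteq> - {i}" "Z \<noteq> UNIV" by auto
  qed
  then have "- Z \<noteq> {}" "\<And>i. - Z \<noteq> {i}" by auto
  then have "card (- Z) \<ge> 2"
    by (metis Suc_leI card_1_singletonE card_gt_0_iff finite nat_less_le numeral_2_eq_2 One_nat_def)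
  moreover have "card (- Z) = CARD('v) - card Z" "card Z \<le> CARD('v)"
    by (simp_all add: Compl_eq_Diff_UNIV card_Diff_subset card_mono)
  ultimately show ?thesis by linarith
qed

section \<open>Exponent vectors and Stanley decompositions\<close>

text \<open>As \<open>'v\<close> is finite, every function is an exponent vector, and the pointwise
  order on functions is divisibility.\<close>

definition mon :: "('v::finite \<Rightarrow> nat) \<Rightarrow> ('v, 'k::field) mpoly" where
  "mon a = monom (Abs_poly_mapping a)"

definition exps :: "('v::finite, 'k::field) mpoly set \<Rightarrow> ('v \<Rightarrow> nat) set" where
  "exps I = {a. mon a \<in> I}"

text \<open>The \<open>K\<close>-span of the monomials with exponents in \<open>X\<close>. Monomial
  ideals, their complements and Stanley spaces all have this form, which turns statements on vector
  spaces into statements on sets of exponents.\<close>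

definition polys_on :: "('v::finite \<Rightarrow> nat) set \<Rightarrow> ('v, 'k::field) mpoly set" where
  "polys_on X = {f. \<forall>k\<in>Poly_Mapping.keys f. Poly_Mapping.lookup k \<in> X}"

lemma lookup_Abs [simp]: "Poly_Mapping.lookup (Abs_poly_mapping a) = (a :: 'v::finite \<Rightarrow> nat)"
  by simp

lemma monom_eq_mon: "monom k = mon (Poly_Mapping.lookup k)"
  by (simp add: mon_def)

lemma mon_eq_iff [simp]: "(mon a :: ('v::finite, 'k::field) mpoly) = mon b \<longleftrightarrow> a = b"
  unfolding mon_def monom_eq_iff by (metis lookup_Abs)

lemma mon_dvd_iff: "(mon a :: ('v::finite, 'k::field) mpoly) dvd mon b \<longleftrightarrow> a \<le> b"
  by (simp add: mon_def monom_dvd_iff le_fun_def)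

lemma mon_mult: "mon a * mon b = (mon (\<lambda>i. a i + b i) :: ('v::finite, 'k::field) mpoly)"
proof -
  have "Abs_poly_mapping a + Abs_poly_mapping b = Abs_poly_mapping (\<lambda>i. a i + b i)"
    by (intro poly_mapping_eqI) (simp add: lookup_add)
  then show ?thesis by (simp add: mon_def monom_mult)
qed

lemma monomials_eq_mon: "monomials = range (mon :: _ \<Rightarrow> ('v::finite, 'k::field) mpoly)"
proof
  show "monomials \<subseteq> range (mon :: _ \<Rightarrow> ('v, 'k) mpoly)"
    by (auto simp: monomials_def monom_eq_mon)
qed (auto simp: mon_def)

lemma mon_in_monomials [simp]: "mon a \<in> monomials"
  by (simp add: monomials_eq_mon)

lemma keys_mon [simp]: "Poly_Mapping.keys (mon a :: ('v::finite, 'k::field) mpoly) = {Abs_poly_mapping a}"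
  by (simp add: mon_def monom_def)

lemma mon_in_polys_on [simp]: "mon a \<in> polys_on X \<longleftrightarrow> a \<in> X"
  by (simp add: polys_on_def)

lemma sum_monoms:
  fixes f :: "('v::finite, 'k::field) mpoly"
  shows "f = (\<Sum>k\<in>Poly_Mapping.keys f. Poly_Mapping.single 0 (Poly_Mapping.lookup f k) * monom k)"
proof -
  have "Poly_Mapping.lookup (\<Sum>k\<in>Poly_Mapping.keys f. Poly_Mapping.single k (Poly_Mapping.lookup f k)) l
      = Poly_Mapping.lookup f l" for l
    by (simp add: lookup_sum lookup_single when_def in_keys_iff)
  then show ?thesis
    by (intro poly_mapping_eqI) (simp add: monom_def mult_single)
qed

lemma polys_on_add: "f \<in> polys_on X \<Longrightarrow> g \<in> polys_on X \<Longrightarrow> f + g \<in> polys_on X"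
  using Poly_Mapping.keys_add[of f g] by (auto simp: polys_on_def)

lemma polys_on_sum: "(\<And>i. i \<in> A \<Longrightarrow> g i \<in> polys_on X) \<Longrightarrow> (\<Sum>i\<in>A. g i) \<in> polys_on X"
  by (induction A rule: infinite_finite_induct) (auto intro: polys_on_add, auto simp: polys_on_def)

lemma kspan_mon: "kspan (mon ` X) = (polys_on X :: ('v::finite, 'k::field) mpoly set)"
proof -
  interpret vector_space "\<lambda>c (f :: ('v, 'k) mpoly). Poly_Mapping.single 0 c * f"
    by (rule vector_space_mpoly)
  show ?thesis
  proof
    have "Poly_Mapping.single 0 c * f \<in> polys_on X" if "f \<in> polys_on X" for c and f :: "('v, 'k) mpoly"
      using that keys_mult[of "Poly_Mapping.single 0 c" f]
      by (fastforce simp: polys_on_def split: if_splits)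
    then have "subspace (polys_on X :: ('v, 'k) mpoly set)"
      by (intro subspaceI polys_on_add) (simp_all add: polys_on_def)
    then show "span (mon ` X) \<subseteq> (polys_on X :: ('v, 'k) mpoly set)"
      by (intro span_minimal) auto
    show "(polys_on X :: ('v, 'k) mpoly set) \<subseteq> span (mon ` X)"
    proof
      fix f :: "('v, 'k) mpoly" assume f: "f \<in> polys_on X"
      show "f \<in> span (mon ` X)"
        by (subst sum_monoms, intro span_sum span_scale span_base)
          (use f in \<open>auto simp: polys_on_def monom_eq_mon\<close>)
    qed
  qed
qed

text \<open>Since \<open>exps I\<close> is an up-set, the polynomials with exponents in it form an
  ideal, and this ideal contains the monomial generators. Membership in \<open>I\<close> can
  therefore be tested term by term.\<close>

lemma monomial_ideal_polys_on:
  fixes I :: "('v::finite, 'k::field) mpoly set"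
  assumes "monomial_ideal I"
  shows "I = polys_on (exps I)"
proof -
  interpret module "(*) :: ('v, 'k) mpoly \<Rightarrow> _" by (rule module_times)
  obtain M where M: "M \<subseteq> monomials" "I = span M"
    using assms by (auto simp: monomial_ideal_def)
  have up: "b \<in> exps I" if "a \<in> exps I" "a \<le> b" for a b
  proof -
    have "(mon a :: ('v, 'k) mpoly) dvd mon b" using that(2) by (simp add: mon_dvd_iff)
    then obtain q :: "('v, 'k) mpoly" where "mon b = mon a * q" by (elim dvdE)
    then show ?thesis
      using that(1) span_scale[of "mon a" M q] by (simp add: exps_def M(2) mult.commute)
  qed
  have "subspace (polys_on (exps I) :: ('v, 'k) mpoly set)"
  proof (intro subspaceI polys_on_add)
    fix c f :: "('v, 'k) mpoly" assume f: "f \<in> polys_on (exps I)"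
    have "Poly_Mapping.lookup k \<in> exps I" if k: "k \<in> Poly_Mapping.keys (c * f)" for k
    proof -
      obtain x y where "k = x + y" "y \<in> Poly_Mapping.keys f"
        using keys_mult[of c f] k by blast
      then have "Poly_Mapping.lookup y \<in> exps I" "Poly_Mapping.lookup y \<le> Poly_Mapping.lookup k"
        using f by (auto simp: polys_on_def lookup_add le_fun_def)
      then show ?thesis by (rule up)
    qed
    then show "c * f \<in> polys_on (exps I)" by (simp add: polys_on_def)
  qed (auto simp: polys_on_def)
  moreover have "M \<subseteq> polys_on (exps I)"
  proof
    fix u assume "u \<in> M"
    then show "u \<in> polys_on (exps I)"
      using M(1) span_base[of u M] by (auto simp: monomials_eq_mon exps_def M(2))
  qed
  ultimately have "I \<subseteq> polys_on (exps I)"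
    unfolding M(2) by (intro span_minimal)
  moreover have "f \<in> I" if "f \<in> polys_on (exps I)" for f
    unfolding M(2)
    by (subst sum_monoms, intro span_sum span_scale)
      (use that in \<open>auto simp: polys_on_def exps_def monom_eq_mon M(2)\<close>)
  ultimately show ?thesis by blast
qed

lemma monomial_ideal_gen: "M \<subseteq> monomials \<Longrightarrow> monomial_ideal (ideal_gen M)"
  by (auto simp: monomial_ideal_def)

lemma exps_ideal_gen:
  "exps (ideal_gen (mon ` G) :: ('v::finite, 'k::field) mpoly set) = upset G"
proof -
  interpret module "(*) :: ('v, 'k) mpoly \<Rightarrow> _" by (rule module_times)
  have "mon b \<in> span (mon ` G :: ('v, 'k) mpoly set)" if "g \<in> G" "g \<le> b" for g b
  proof -
    have "(mon g :: ('v, 'k) mpoly) dvd mon b" using that(2) by (simp add: mon_dvd_iff)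
    then obtain q :: "('v, 'k) mpoly" where q: "mon b = mon g * q" by (elim dvdE)
    have "q * mon g \<in> span (mon ` G)" using that(1) by (intro span_scale span_base) auto
    then show ?thesis by (simp add: q mult.commute)
  qed
  moreover have "\<exists>g\<in>G. g \<le> b" if "mon b \<in> span (mon ` G :: ('v, 'k) mpoly set)" for b
    using monomial_in_ideal_gen[of "mon ` G" "mon b :: ('v, 'k) mpoly"] that by (auto simp: mon_dvd_iff image_subset_iff)
  ultimately show ?thesis by (auto simp: exps_def upset_def)
qed

lemma stanley_space_mon: "stanley_space (mon c) Z = (polys_on (block c Z) :: ('v::finite, 'k::field) mpoly set)"
proof -
  have "{mon c * w | w. w \<in> monomials_in Z} = (mon ` block c Z :: ('v, 'k) mpoly set)"
  proof (intro equalityI subsetI)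
    fix f :: "('v, 'k) mpoly" assume "f \<in> {mon c * w | w. w \<in> monomials_in Z}"
    then obtain a where a: "f = mon c * monom a" "Poly_Mapping.keys a \<subseteq> Z"
      by (auto simp: monomials_in_def)
    have "Poly_Mapping.lookup a i = 0" if "i \<notin> Z" for i
      using a(2) that by (metis in_keys_iff subsetD)
    then have "(\<lambda>i. c i + Poly_Mapping.lookup a i) \<in> block c Z"
      by (auto simp: block_def)
    then show "f \<in> mon ` block c Z" by (auto simp: a(1) monom_eq_mon mon_mult)
  next
    fix f :: "('v, 'k) mpoly" assume "f \<in> mon ` block c Z"
    then obtain b where b: "f = mon b" "b \<in> block c Z" by blast
    have "c i + (b i - c i) = b i" for i
      using b(2) by (cases "i \<in> Z") (auto simp: block_def)
    then have "f = mon c * mon (\<lambda>i. b i - c i)" by (simp add: b(1) mon_mult)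
    moreover have "mon (\<lambda>i. b i - c i) \<in> (monomials_in Z :: ('v, 'k) mpoly set)"
      using b(2) by (fastforce simp: monomials_in_def mon_def in_keys_iff block_def)
    ultimately show "f \<in> {mon c * w | w. w \<in> monomials_in Z}" by blast
  qed
  then show ?thesis by (simp add: stanley_space_def kspan_mon)
qed

text \<open>The terms of a polynomial are sorted by the set containing their exponent. Each exponent
  belongs to one set only, so nothing cancels between different summands.\<close>

lemma direct_sum_polys_on:
  fixes B :: "'i \<Rightarrow> ('v::finite \<Rightarrow> nat) set"
  assumes fin: "finite S" and disj: "\<And>i j. i \<in> S \<Longrightarrow> j \<in> S \<Longrightarrow> i \<noteq> j \<Longrightarrow> B i \<inter> B j = {}"
  shows "internal_direct_sum S (\<lambda>i. polys_on (B i)) (polys_on (\<Union>i\<in>S. B i) :: ('v, 'k::field) mpoly set)"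
  unfolding internal_direct_sum_def
proof (intro conjI equalityI subsetI allI impI ballI)
  fix f :: "('v, 'k) mpoly" assume f: "f \<in> polys_on (\<Union>i\<in>S. B i)"
  define K where "K i = {k \<in> Poly_Mapping.keys f. Poly_Mapping.lookup k \<in> B i}" for i
  define g :: "'i \<Rightarrow> ('v, 'k) mpoly" where
    "g i = (\<Sum>k\<in>K i. Poly_Mapping.single 0 (Poly_Mapping.lookup f k) * monom k)" for i
  have "Poly_Mapping.keys f = (\<Union>i\<in>S. K i)"
    using f by (auto simp: polys_on_def K_def)
  moreover have "K i \<inter> K j = {}" if "i \<in> S" "j \<in> S" "i \<noteq> j" for i j
    using disj[OF that] by (auto simp: K_def)
  moreover have "finite (K i)" for i by (simp add: K_def)
  ultimately have "f = (\<Sum>i\<in>S. g i)"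
    unfolding g_def by (subst sum_monoms[of f]) (simp add: sum.UNION_disjoint[OF fin])
  moreover have "g i \<in> polys_on (B i)" for i
    unfolding g_def
    by (intro polys_on_sum) (auto simp: K_def monom_def mult_single polys_on_def)
  ultimately show "f \<in> {\<Sum>i\<in>S. g i | g. \<forall>i\<in>S. g i \<in> polys_on (B i)}" by blast
next
  fix f :: "('v, 'k) mpoly" assume "f \<in> {\<Sum>i\<in>S. g i | g. \<forall>i\<in>S. g i \<in> polys_on (B i)}"
  then obtain g where g: "f = (\<Sum>i\<in>S. g i)" "\<forall>i\<in>S. g i \<in> polys_on (B i)" by blast
  show "f \<in> polys_on (\<Union>i\<in>S. B i)"
    unfolding g(1) by (intro polys_on_sum) (use g(2) in \<open>auto simp: polys_on_def\<close>)
next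
  fix g :: "'i \<Rightarrow> ('v, 'k) mpoly" and i
  assume g: "(\<forall>i\<in>S. g i \<in> polys_on (B i)) \<and> (\<Sum>i\<in>S. g i) = 0" and i: "i \<in> S"
  have "Poly_Mapping.lookup (g i) k = 0" for k
  proof (rule ccontr)
    assume "Poly_Mapping.lookup (g i) k \<noteq> 0"
    then have "k \<in> Poly_Mapping.keys (g i)" by (simp add: in_keys_iff)
    then have k: "Poly_Mapping.lookup k \<in> B i" using g i by (auto simp: polys_on_def)
    have "Poly_Mapping.lookup (g j) k = 0" if j: "j \<in> S - {i}" for j
    proof -
      have "Poly_Mapping.lookup k \<notin> B j" using disj[of i j] j i k by auto
      then have "k \<notin> Poly_Mapping.keys (g j)" using g j by (auto simp: polys_on_def)
      then show ?thesis by (simp add: in_keys_iff)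
    qed
    then have "(\<Sum>j\<in>S. Poly_Mapping.lookup (g j) k) = Poly_Mapping.lookup (g i) k"
      by (subst sum.remove[OF fin i]) simp
    then have "Poly_Mapping.lookup (\<Sum>j\<in>S. g j) k = Poly_Mapping.lookup (g i) k"
      by (simp add: lookup_sum)
    then show False using g \<open>Poly_Mapping.lookup (g i) k \<noteq> 0\<close> by simp
  qed
  then show "g i = 0" by (intro poly_mapping_eqI) simp
qed

section \<open>Stanley decompositions and block partitions\<close>

lemma kspan_complement:
  "kspan (monomials \<inter> (UNIV - I)) = (polys_on (- exps I) :: ('v::finite, 'k::field) mpoly set)"
proof -
  have "monomials \<inter> (UNIV - I) = mon ` (- exps I)"
    by (auto simp: monomials_eq_mon exps_def)
  then show ?thesis by (simp add: kspan_mon)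
qed

lemma stanley_decomposition_of_partition:
  fixes I :: "('v::finite, 'k::field) mpoly set"
  assumes "block_partition P (- exps I)"
  shows "\<exists>D. stanley_decomposition UNIV I D \<and> snd ` set D = snd ` P"
proof -
  have "finite P" using assms by (simp add: block_partition_def)
  then obtain L where L: "set L = P" "distinct L"
    using finite_distinct_list by metis
  define D :: "(('v, 'k) mpoly \<times> 'v set) list" where "D = map (\<lambda>(c, Z). (mon c, Z)) L"
  have len: "length D = length L" by (simp add: D_def)
  have D: "stanley_space (fst (D ! i)) (snd (D ! i)) = polys_on (block (fst (L ! i)) (snd (L ! i)))"
    if "i < length L" for i
    using that by (simp add: D_def case_prod_beta stanley_space_mon)
  have P: "- exps I = (\<Union>p\<in>set L. block (fst p) (snd p))"
    "\<forall>p\<in>set L. \<forall>q\<in>set L. p \<noteq> q \<longrightarrow> block (fst p) (snd p) \<inter> block (fst q) (snd q) = {}"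
    using assms L by (auto simp: block_partition_def)
  \<comment> \<open>The sum is indexed by list positions, so distinctness of \<open>L\<close> is
    what makes different positions carry disjoint blocks.\<close>
  have "internal_direct_sum {..<length L} (\<lambda>i. polys_on (block (fst (L ! i)) (snd (L ! i))))
      (polys_on (\<Union>i\<in>{..<length L}. block (fst (L ! i)) (snd (L ! i))) :: ('v, 'k) mpoly set)"
    using P(2) L(2) by (intro direct_sum_polys_on) (auto simp: nth_eq_iff_index_eq)
  moreover have "(\<Union>i\<in>{..<length L}. block (fst (L ! i)) (snd (L ! i))) = - exps I"
    unfolding P(1) by (auto simp: set_conv_nth)
  ultimately have "internal_direct_sum {..<length D} (\<lambda>i. stanley_space (fst (D ! i)) (snd (D ! i)))
      (polys_on (- exps I))"
    using D by (simp add: internal_direct_sum_def len)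
  then have "stanley_decomposition UNIV I D"
    unfolding stanley_decomposition_def kspan_complement by (auto simp: D_def)
  moreover have "snd ` set D = snd ` P"
    by (force simp: D_def L)
  ultimately show ?thesis by blast
qed

text \<open>Upper bounds on the depth come from a single monomial outside \<open>I\<close>: in every
  decomposition some summand contributes its coefficient, and that summand avoids \<open>I\<close>
  because each of its monomials, padded with zeros, is itself a sum in the complement.\<close>

lemma stanley_decomposition_block:
  fixes I :: "('v::finite, 'k::field) mpoly set"
  assumes D: "stanley_decomposition UNIV I D" and a: "a \<notin> exps I"
  shows "\<exists>c Z. (mon c, Z) \<in> set D \<and> a \<in> block c Z \<and> block c Z \<inter> exps I = {}"
proof -
  define W where "W i = stanley_space (fst (D ! i)) (snd (D ! i))" for i
  have V: "polys_on (- exps I) = {\<Sum>i<length D. g i | g. \<forall>i\<in>{..<length D}. g i \<in> W i}"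
    using D unfolding stanley_decomposition_def internal_direct_sum_def kspan_complement W_def by blast
  have W: "\<exists>c. fst (D ! i) = mon c \<and> W i = polys_on (block c (snd (D ! i)))" if "i < length D" for i
  proof -
    have "fst (D ! i) \<in> monomials"
      using D nth_mem[OF that] by (auto simp: stanley_decomposition_def)
    then show ?thesis by (auto simp: W_def monomials_eq_mon stanley_space_mon)
  qed
  have "(mon a :: ('v, 'k) mpoly) \<in> polys_on (- exps I)" using a by simp
  then obtain g where g: "mon a = (\<Sum>i<length D. g i)" "\<forall>i\<in>{..<length D}. g i \<in> W i"
    unfolding V by blast
  have "Poly_Mapping.lookup (mon a :: ('v, 'k) mpoly) (Abs_poly_mapping a) \<noteq> 0"
    by (simp add: mon_def monom_def)
  then have "(\<Sum>i<length D. Poly_Mapping.lookup (g i) (Abs_poly_mapping a)) \<noteq> 0"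
    by (simp add: g(1) lookup_sum)
  then obtain i where i: "i < length D" "Poly_Mapping.lookup (g i) (Abs_poly_mapping a) \<noteq> 0"
    by (meson lessThan_iff sum.not_neutral_contains_not_neutral)
  obtain c where c: "fst (D ! i) = mon c" "W i = polys_on (block c (snd (D ! i)))" using W i(1) by blast
  have "a \<in> block c (snd (D ! i))"
    using g(2) i c(2) by (force simp: polys_on_def in_keys_iff)
  moreover have "b \<notin> exps I" if b: "b \<in> block c (snd (D ! i))" for b
  proof -
    have "0 \<in> W j" if "j < length D" for j using W[OF that] by (auto simp: polys_on_def)
    moreover have "mon b \<in> W i" using b by (simp add: c(2))
    ultimately have "\<forall>j\<in>{..<length D}. (if j = i then mon b else 0) \<in> W j" by simp
    then have "(\<Sum>j<length D. if j = i then mon b else 0 :: ('v, 'k) mpoly) \<in> polys_on (- exps I)"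
      unfolding V by blast
    then show ?thesis using i(1) by simp
  qed
  moreover have "(mon c, snd (D ! i)) \<in> set D"
    using nth_mem[OF i(1)] c(1) by (metis prod.collapse)
  ultimately show ?thesis by blast
qed

section \<open>Stanley depth and the socle\<close>

definition mins :: "('v \<Rightarrow> nat) set \<Rightarrow> ('v \<Rightarrow> nat) set" where
  "mins E = {a \<in> E. \<forall>b\<in>E. b \<le> a \<longrightarrow> b = a}"

text \<open>An antichain is the set of minimal generators of the ideal it generates. The property
  passes to subsets, as needed for \<open>I_\<sigma>\<close>, and to the quotients by the gcd, as
  needed for \<open>I'\<close>.\<close>

definition antichain :: "('v \<Rightarrow> nat) set \<Rightarrow> bool" where
  "antichain G \<longleftrightarrow> (\<forall>a\<in>G. \<forall>b\<in>G. a \<le> b \<longrightarrow> a = b)"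

text \<open>The exponent vector of the gcd of the monomials in \<open>G\<close>.\<close>

definition lower :: "('v \<Rightarrow> nat) set \<Rightarrow> 'v \<Rightarrow> nat" where
  "lower G i = (INF g\<in>G. g i)"

lemma antichain_mins: "antichain (mins E)"
  unfolding antichain_def mins_def by blast

lemma mins_upset:
  assumes "antichain G"
  shows "mins (upset G) = G"
proof (intro equalityI subsetI)
  fix b assume b: "b \<in> mins (upset G)"
  then obtain g where g: "g \<in> G" "g \<le> b" by (auto simp: mins_def upset_def)
  have "g \<in> upset G" using g(1) by (auto simp: upset_def)
  then have "g = b" using b g(2) by (simp add: mins_def)
  then show "b \<in> G" using g(1) by simp
next
  fix g assume g: "g \<in> G"
  have "c = g" if c: "c \<in> upset G" "c \<le> g" for c
  proof -
    obtain h where h: "h \<in> G" "h \<le> c" using c(1) by (auto simp: upset_def)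
    have "h = g" using assms g h(1) order_trans[OF h(2) c(2)] by (simp add: antichain_def)
    then show ?thesis using h(2) c(2) by simp
  qed
  moreover have "g \<in> upset G" using g by (auto simp: upset_def)
  ultimately show "g \<in> mins (upset G)" by (simp add: mins_def)
qed

lemma mingens_eq: "mingens I = (mon ` mins (exps I) :: ('v::finite, 'k::field) mpoly set)"
proof -
  have "(\<forall>w\<in>monomials \<inter> I. Q w) \<longleftrightarrow> (\<forall>b. mon b \<in> I \<longrightarrow> Q (mon b))" for Q
    unfolding monomials_eq_mon by blast
  then have "(mon a :: ('v, 'k) mpoly) \<in> mingens I \<longleftrightarrow> a \<in> mins (exps I)" for a
    by (simp add: mingens_def mins_def exps_def mon_dvd_iff)
  moreover have "mingens I \<subseteq> range mon"
    by (auto simp: mingens_def monomials_eq_mon)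
  ultimately show ?thesis by blast
qed

lemma inj_mon: "inj_on (mon :: _ \<Rightarrow> ('v::finite, 'k::field) mpoly) A"
  by (rule inj_onI) simp

lemma num_mingens_eq: "num_mingens (I :: ('v::finite, 'k::field) mpoly set) = card (mins (exps I))"
  unfolding num_mingens_def mingens_eq by (rule card_image[OF inj_mon])

lemma exps_eq_upset_mins:
  fixes I :: "('v::finite, 'k::field) mpoly set"
  assumes "monomial_ideal I"
  shows "exps I = upset (mins (exps I))"
  using ideal_gen_mingens[OF assms] exps_ideal_gen unfolding mingens_eq by metis

lemma zero_notin_exps:
  fixes I :: "('v::finite, 'k::field) mpoly set"
  assumes "monomial_ideal I" "I \<noteq> UNIV"
  shows "(\<lambda>_. 0) \<notin> exps I"
proof
  assume "(\<lambda>_. 0) \<in> exps I"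
  then have "b \<in> exps I" for b
    using exps_eq_upset_mins[OF assms(1)] upset_mono[of "\<lambda>_. 0" _ b] by (metis le_funI le0)
  then have "polys_on (exps I) = (UNIV :: ('v, 'k) mpoly set)" by (auto simp: polys_on_def)
  then show False using monomial_ideal_polys_on[OF assms(1)] assms(2) by simp
qed

section \<open>Bounds for the Stanley depth\<close>

lemma sdepth_decomp_le:
  assumes "(u, Z) \<in> set D"
  shows "sdepth_decomp D \<le> card Z"
  unfolding sdepth_decomp_def using assms by (intro Min_le) force+

text \<open>A monomial outside \<open>I\<close> forces every decomposition to be nonempty, so that
  no \<open>Min\<close> over the empty set enters.\<close>

lemma finite_sdepths:
  fixes I :: "('v::finite, 'k::field) mpoly set"
  assumes "a \<notin> exps I"
  shows "finite {sdepth_decomp D | D. stanley_decomposition UNIV I D}"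
proof (rule finite_subset)
  show "{sdepth_decomp D | D. stanley_decomposition UNIV I D} \<subseteq> {..CARD('v)}"
  proof
    fix d assume "d \<in> {sdepth_decomp D | D. stanley_decomposition UNIV I D}"
    then obtain D where D: "d = sdepth_decomp D" "stanley_decomposition UNIV I D" by blast
    then obtain c Z where "(mon c, Z) \<in> set D"
      using stanley_decomposition_block[OF D(2) assms] by blast
    then have "d \<le> card Z" unfolding D(1) by (rule sdepth_decomp_le)
    also have "\<dots> \<le> CARD('v)" by (intro card_mono) auto
    finally show "d \<in> {..CARD('v)}" by simp
  qed
qed simp

lemma sdepth_ge:
  fixes I :: "('v::finite, 'k::field) mpoly set"
  assumes a: "a \<notin> exps I" and P: "block_partition P (- exps I)" "\<And>p. p \<in> P \<Longrightarrow> k \<le> card (snd p)"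
  shows "k \<le> sdepth UNIV I"
proof -
  obtain D where D: "stanley_decomposition UNIV I D" "snd ` set D = snd ` P"
    using stanley_decomposition_of_partition[OF P(1)] by blast
  have "set D \<noteq> {}" using stanley_decomposition_block[OF D(1) a] by auto
  moreover have "k \<le> card Z" if Z: "(u, Z) \<in> set D" for u Z
  proof -
    have "Z \<in> snd ` P" using Z unfolding D(2)[symmetric] by force
    then show ?thesis using P(2) by auto
  qed
  ultimately have "k \<le> sdepth_decomp D"
    unfolding sdepth_decomp_def by (intro Min.boundedI) auto
  also have "\<dots> \<le> sdepth UNIV I"
    unfolding sdepth_def using D(1) finite_sdepths[OF a] by (intro Max_ge) blast+
  finally show ?thesis .
qed

text \<open>The partition \<open>P\<close> guarantees that \<open>Max\<close> ranges over a nonempty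
  set; \<open>a\<close> is the test monomial whose block limits every decomposition.\<close>

lemma sdepth_le:
  fixes I :: "('v::finite, 'k::field) mpoly set"
  assumes a: "a \<notin> exps I" and P: "block_partition P (- exps I)"
    and le: "\<And>c Z. a \<in> block c Z \<Longrightarrow> block c Z \<inter> exps I = {} \<Longrightarrow> card Z \<le> k"
  shows "sdepth UNIV I \<le> k"
  unfolding sdepth_def
proof (rule Max.boundedI[OF finite_sdepths[OF a]])
  show "{sdepth_decomp D | D. stanley_decomposition UNIV I D} \<noteq> {}"
    using stanley_decomposition_of_partition[OF P] by blast
  fix d assume "d \<in> {sdepth_decomp D | D. stanley_decomposition UNIV I D}"
  then obtain D where D: "d = sdepth_decomp D" "stanley_decomposition UNIV I D" by blast
  obtain c Z where Z: "(mon c, Z) \<in> set D" "a \<in> block c Z" "block c Z \<inter> exps I = {}"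
    using stanley_decomposition_block[OF D(2) a] by blast
  show "d \<le> k" using sdepth_decomp_le[OF Z(1)] le[OF Z(2,3)] by (simp add: D(1))
qed

text \<open>For the upper bound the test monomial is 1: a block containing it starts at 1, and with
  all directions free it would contain the generator.\<close>

lemma sdepth_principal:
  fixes I :: "('v::{finite, linorder}, 'k::field) mpoly set"
  assumes E: "exps I = upset {g}" and z: "(\<lambda>_. 0) \<notin> exps I"
  shows "sdepth UNIV I = CARD('v) - 1"
proof (rule antisym)
  obtain P where P: "block_partition P (- exps I)" "\<And>p. p \<in> P \<Longrightarrow> card (snd p) = CARD('v) - 1"
    using partition_principal_compl[of g] E by metis
  show "CARD('v) - 1 \<le> sdepth UNIV I"
    using P(2) by (intro sdepth_ge[OF z P(1)]) simp
  show "sdepth UNIV I \<le> CARD('v) - 1"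
  proof (rule sdepth_le[OF z P(1)])
    fix c and Z :: "'v set" assume c: "(\<lambda>_. 0) \<in> block c Z" and disj: "block c Z \<inter> exps I = {}"
    have "Z \<noteq> UNIV"
    proof
      assume "Z = UNIV"
      then have "g \<in> block c Z" using c by (auto simp: block_def)
      then show False using disj by (auto simp: E upset_def)
    qed
    then have "card Z < CARD('v)" by (intro psubset_card_mono) auto
    then show "card Z \<le> CARD('v) - 1" by simp
  qed
qed

lemma sdepth_socle:
  fixes I :: "('v::{finite, linorder}, 'k::field) mpoly set"
  assumes E: "exps I = upset G" and G: "finite G" and a: "a \<in> socle (exps I)"
  shows "sdepth UNIV I = 0"
proof -
  obtain P where P: "block_partition P (- exps I)"
    using partition_upset_compl[OF G] E by metis
  have "sdepth UNIV I \<le> 0"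
  proof (rule sdepth_le[OF _ P])
    show "a \<notin> exps I" using a by (simp add: socle_def)
    fix c and Z :: "'v set" assume c: "a \<in> block c Z" and disj: "block c Z \<inter> exps I = {}"
    have "i \<notin> Z" for i
    proof
      assume "i \<in> Z"
      then have "a(i := Suc (a i)) \<in> block c Z" using c by (auto simp: block_def le_SucI)
      then show False using a disj by (auto simp: socle_def)
    qed
    then have "Z = {}" by blast
    then show "card Z \<le> 0" by simp
  qed
  then show ?thesis by simp
qed

lemma sdepth_pos:
  fixes I :: "('v::{finite, linorder}, 'k::field) mpoly set"
  assumes E: "exps I = upset G" and G: "finite G" and z: "a \<notin> exps I" and s: "socle (exps I) = {}"
  shows "1 \<le> sdepth UNIV I"
proof -
  obtain P where P: "block_partition P (- exps I)" "\<And>p. p \<in> P \<Longrightarrow> snd p \<noteq> {}"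
    using partition_upset_compl[OF G] E s by metis
  show ?thesis
    by (rule sdepth_ge[OF z P(1)]) (use P(2) in \<open>auto simp: Suc_le_eq card_gt_0_iff\<close>)
qed

section \<open>The gcd of the generators and non-principal ideals\<close>

lemma lower_le: "g \<in> G \<Longrightarrow> lower G i \<le> g i"
  unfolding lower_def by (intro cINF_lower) auto

lemma lower_attained:
  assumes "G \<noteq> {}"
  shows "\<exists>g\<in>G. g i = lower G i"
  using Inf_nat_def1[of "(\<lambda>g. g i) ` G"] assms by (auto simp: lower_def)

text \<open>If the gcd lay in the ideal, one generator would divide all the others and hence be the
  only one.\<close>

lemma lower_notin_upset:
  assumes "antichain G" "card G \<noteq> 1"
  shows "lower G \<notin> upset G"
proof
  assume "lower G \<in> upset G"
  then obtain g where g: "g \<in> G" "g \<le> lower G" by (auto simp: upset_def)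
  have "h = g" if "h \<in> G" for h
  proof -
    have "g \<le> h" using g(2) lower_le[OF that] by (auto simp: le_fun_def intro: order_trans)
    then show ?thesis using assms(1) g(1) that by (auto simp: antichain_def)
  qed
  then have "G = {g}" using g(1) by blast
  then show False using assms(2) by simp
qed

lemma sdepth_nonprincipal_le:
  fixes I :: "('v::{finite, linorder}, 'k::field) mpoly set"
  assumes E: "exps I = upset G" and G: "finite G" "antichain G" "2 \<le> card G"
  shows "sdepth UNIV I \<le> CARD('v) - 2"
proof -
  obtain P where P: "block_partition P (- exps I)"
    using partition_upset_compl[OF G(1)] E by metis
  have ne: "G \<noteq> {}" using G(3) by auto
  show ?thesis
  proof (rule sdepth_le[OF _ P])
    show "lower G \<notin> exps I" using lower_notin_upset[OF G(2)] G(3) by (simp add: E)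
    show "card Z \<le> CARD('v) - 2" if "lower G \<in> block c Z" "block c Z \<inter> exps I = {}" for c Z
      using card_block_directions_le[OF that(1) _ G(1) ne lower_attained[OF ne]] that(2) by (simp add: E)
  qed
qed

text \<open>Stated for an arbitrary antichain so that it applies alike to \<open>I\<close>, to
  \<open>I'\<close> and to the ideals \<open>I_\<sigma>\<close>; all depth claims except the
  principal case reduce to it.\<close>

lemma sdepth_eq_if:
  fixes I :: "(3, 'k::field) mpoly set"
  assumes E: "exps I = upset G" and G: "finite G" "antichain G" "2 \<le> card G"
  shows "sdepth UNIV I = (if socle (upset G) = {} then 1 else 0)"
proof (cases "socle (upset G) = {}")
  case True
  have "lower G \<notin> exps I" using lower_notin_upset[OF G(2)] G(3) by (simp add: E)
  then have "1 \<le> sdepth UNIV I" using True by (intro sdepth_pos[OF E G(1)]) (simp_all add: E)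
  then show ?thesis using sdepth_nonprincipal_le[OF E G] True by simp
next
  case False
  then show ?thesis using sdepth_socle[OF E G(1)] by (auto simp: E)
qed

text \<open>A generator dividing \<open>x_i\<close> times the monomial of \<open>a\<close> does not
  divide that monomial itself, so it must use up the additional factor \<open>x_i\<close>.\<close>

lemma socle_generators:
  assumes "a \<in> socle (upset G)"
  obtains u where "\<And>i. u i \<in> G" "\<And>i. u i i = Suc (a i)" "\<And>i j. j \<noteq> i \<Longrightarrow> u i j \<le> a j"
proof -
  have "\<exists>g\<in>G. g i = Suc (a i) \<and> (\<forall>j. j \<noteq> i \<longrightarrow> g j \<le> a j)" for i
  proof -
    obtain g where g: "g \<in> G" "g \<le> a(i := Suc (a i))"
      using assms by (auto simp: socle_def upset_def)
    have le: "g j \<le> a j" if "j \<noteq> i" for j using le_funD[OF g(2), of j] that by simp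
    have "\<not> g \<le> a" using assms g(1) by (auto simp: socle_def upset_def)
    then have "\<not> g i \<le> a i" using le by (metis le_funI)
    then have "g i = Suc (a i)" using le_funD[OF g(2), of i] by simp
    then show ?thesis using g(1) le by blast
  qed
  then show ?thesis using that by metis
qed

lemma card_ge_of_socle:
  fixes G :: "('v::finite \<Rightarrow> nat) set"
  assumes "a \<in> socle (upset G)" "finite G"
  shows "CARD('v) \<le> card G"
proof -
  obtain u where u: "\<And>i. u i \<in> G" "\<And>i. u i i = Suc (a i)" "\<And>i j. j \<noteq> i \<Longrightarrow> u i j \<le> a j"
    by (rule socle_generators[OF assms(1)]) blast
  \<comment> \<open>At \<open>i\<close>, the vector \<open>u i\<close> exceeds \<open>a\<close>,
    while every other \<open>u j\<close> does not.\<close>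
  have "inj u"
    by (rule injI) (metis u(2,3) Suc_n_not_le_n)
  then show ?thesis using u(1) assms(2) by (intro card_inj_on_le[of u]) auto
qed

section \<open>Monomial ideals and the ideal \<open>I'\<close>\<close>

text \<open>The exponents of the generators after division by their gcd. Truncated subtraction is
  exact here, as \<open>lower G\<close> bounds every element of \<open>G\<close> from below.\<close>

definition reduced :: "('v \<Rightarrow> nat) set \<Rightarrow> ('v \<Rightarrow> nat) set" where
  "reduced G = (\<lambda>g i. g i - lower G i) ` G"

lemma ideal_gen_mon: "ideal_gen (mon ` G) = (polys_on (upset G) :: ('v::finite, 'k::field) mpoly set)"
proof -
  have "(mon ` G :: ('v, 'k) mpoly set) \<subseteq> monomials" by auto
  then show ?thesis
    using monomial_ideal_polys_on[OF monomial_ideal_gen] exps_ideal_gen by metis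
qed

lemma exps_polys_on [simp]: "exps (polys_on X :: ('v::finite, 'k::field) mpoly set) = X"
  by (simp add: exps_def)

lemma monomial_ideal_polys_on_upset:
  "monomial_ideal (polys_on (upset G) :: ('v::finite, 'k::field) mpoly set)"
  unfolding ideal_gen_mon[symmetric] by (intro monomial_ideal_gen) auto

lemma polys_on_mono: "X \<subseteq> Y \<Longrightarrow> polys_on X \<subseteq> polys_on Y"
  by (auto simp: polys_on_def)

lemma polys_on_mult:
  fixes g h :: "('v::finite, 'k::field) mpoly"
  assumes g: "g \<in> polys_on A" and h: "h \<in> polys_on B"
    and C: "\<And>a b. a \<in> A \<Longrightarrow> b \<in> B \<Longrightarrow> (\<lambda>i. a i + b i) \<in> C"
  shows "g * h \<in> polys_on C"
proof -
  have "Poly_Mapping.lookup k \<in> C" if k: "k \<in> Poly_Mapping.keys (g * h)" for k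
  proof -
    obtain a b where "k = a + b" "a \<in> Poly_Mapping.keys g" "b \<in> Poly_Mapping.keys h"
      using keys_mult[of g h] k by blast
    moreover from this have "Poly_Mapping.lookup k = (\<lambda>i. Poly_Mapping.lookup a i + Poly_Mapping.lookup b i)"
      by (simp add: lookup_add fun_eq_iff)
    ultimately show ?thesis using g h C by (simp add: polys_on_def)
  qed
  then show ?thesis by (simp add: polys_on_def)
qed

text \<open>Multiplication by a monomial shifts exponents injectively and keeps the coefficients, so
  no terms merge. This computes both the colon ideal by the gcd and the one by the
  variables.\<close>

lemma times_mon_in_polys_on:
  fixes f :: "('v::finite, 'k::field) mpoly"
  shows "f * mon v \<in> polys_on X \<longleftrightarrow> f \<in> polys_on {b. (\<lambda>i. b i + v i) \<in> X}"
proof -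
  define w where "w = Abs_poly_mapping v"
  have "f * mon v = (\<Sum>k\<in>Poly_Mapping.keys f. Poly_Mapping.single (k + w) (Poly_Mapping.lookup f k))"
    by (subst sum_monoms[of f])
      (simp add: sum_distrib_right mon_def w_def monom_def mult_single mult.assoc)
  then have lookup: "Poly_Mapping.lookup (f * mon v) (l + w) = Poly_Mapping.lookup f l" for l
    by (simp add: lookup_sum lookup_single when_def in_keys_iff)
  have add_w: "Poly_Mapping.lookup (k + w) = (\<lambda>i. Poly_Mapping.lookup k i + v i)" for k
    by (simp add: w_def lookup_add fun_eq_iff)
  have "Poly_Mapping.keys (f * mon v) = (\<lambda>k. k + w) ` Poly_Mapping.keys f"
  proof
    show "Poly_Mapping.keys (f * mon v) \<subseteq> (\<lambda>k. k + w) ` Poly_Mapping.keys f"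
      using keys_mult[of f "mon v"] by (auto simp: w_def)
  qed (use lookup in \<open>auto simp: in_keys_iff\<close>)
  then show ?thesis by (simp add: polys_on_def add_w)
qed

lemma var_eq_mon: "var i = (mon (\<lambda>j. if j = i then 1 else 0) :: ('v::finite, 'k::field) mpoly)"
proof -
  have "Poly_Mapping.lookup (Poly_Mapping.single i (1 :: nat)) = (\<lambda>j. if j = i then 1 else 0)"
    by (auto simp: lookup_single when_def)
  then show ?thesis by (simp add: var_def monom_eq_mon)
qed

lemma one_eq_mon: "(1 :: ('v::finite, 'k::field) mpoly) = mon (\<lambda>_. 0)"
proof -
  have "Abs_poly_mapping (\<lambda>_. 0) = (0 :: 'v \<Rightarrow>\<^sub>0 nat)" by (intro poly_mapping_eqI) simp
  then show ?thesis by (simp add: mon_def monom_def)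
qed

lemma mon_power: "mon a ^ n = (mon (\<lambda>i. n * a i) :: ('v::finite, 'k::field) mpoly)"
  by (induction n) (simp_all add: one_eq_mon mon_mult)

lemma var_power_eq_mon: "var i ^ n = (mon (\<lambda>j. if j = i then n else 0) :: ('v::finite, 'k::field) mpoly)"
  unfolding var_eq_mon mon_power by (rule arg_cong[of _ _ mon]) auto

section \<open>Division by the gcd\<close>

lemma gcd_monomials_mon:
  assumes "G \<noteq> {}"
  shows "gcd_monomials (mon ` G) = (mon (lower G) :: ('v::finite, 'k::field) mpoly)"
proof -
  have "b \<le> lower G" if "\<forall>g\<in>G. b \<le> g" for b
  proof (rule le_funI)
    fix i
    obtain g where "g \<in> G" "g i = lower G i" using lower_attained[OF assms] by blast
    then show "b i \<le> lower G i" using that by (metis le_funD)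
  qed
  moreover have "\<forall>g\<in>G. lower G \<le> g" using lower_le by (metis le_funI)
  ultimately have *: "(mon (lower G) :: ('v, 'k) mpoly) \<in> monomials \<and> (\<forall>u\<in>mon ` G. mon (lower G) dvd u) \<and>
     (\<forall>w\<in>monomials. (\<forall>u\<in>mon ` G. w dvd u) \<longrightarrow> w dvd mon (lower G))"
    by (auto simp: monomials_eq_mon mon_dvd_iff)
  have "(mon ` G :: ('v, 'k) mpoly set) \<subseteq> monomials" "mon ` G \<noteq> ({} :: ('v, 'k) mpoly set)"
    using assms by auto
  from gcd_monomials_unique_ex[OF this] show ?thesis
    unfolding gcd_monomials_def by (rule the1_equality) (rule *)
qed

lemma upset_reduced: "{b. (\<lambda>i. b i + lower G i) \<in> upset G} = upset (reduced G)"
proof -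
  have "g \<le> (\<lambda>i. b i + lower G i) \<longleftrightarrow> (\<lambda>i. g i - lower G i) \<le> b" if "g \<in> G" for g b
    by (simp add: le_fun_def le_diff_conv)
  then show ?thesis by (auto simp: upset_def reduced_def)
qed

lemma gcd_free_part_eq:
  fixes I :: "('v::finite, 'k::field) mpoly set"
  assumes I: "monomial_ideal I" and G: "G = mins (exps I)" "G \<noteq> {}"
  shows "gcd_free_part I = polys_on (upset (reduced G))"
proof -
  have I_eq: "I = polys_on (upset G)"
    using monomial_ideal_polys_on[OF I] exps_eq_upset_mins[OF I] by (simp add: G(1))
  show ?thesis
    unfolding gcd_free_part_def mingens_eq G(1)[symmetric] gcd_monomials_mon[OF G(2)] colon_def
    by (subst I_eq) (auto simp: times_mon_in_polys_on upset_reduced)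
qed

lemma inj_on_reduced: "inj_on (\<lambda>g i. g i - lower G i) G"
proof (rule inj_onI)
  fix g h assume gh: "g \<in> G" "h \<in> G" "(\<lambda>i. g i - lower G i) = (\<lambda>i. h i - lower G i)"
  show "g = h"
  proof
    fix i show "g i = h i"
      using fun_cong[OF gh(3), of i] lower_le[OF gh(1), of i] lower_le[OF gh(2), of i] by simp
  qed
qed

lemma card_reduced [simp]: "card (reduced G) = card G"
  unfolding reduced_def by (rule card_image[OF inj_on_reduced])

lemma antichain_reduced:
  assumes "antichain G"
  shows "antichain (reduced G)"
proof -
  have "g \<le> h" if "g \<in> G" "h \<in> G" "(\<lambda>i. g i - lower G i) \<le> (\<lambda>i. h i - lower G i)" for g h
  proof (rule le_funI)
    fix i show "g i \<le> h i"
      using le_funD[OF that(3), of i] lower_le[OF that(1), of i] lower_le[OF that(2), of i] by simp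
  qed
  then show ?thesis using assms unfolding antichain_def reduced_def by blast
qed

lemma reduced_attains_zero: "G \<noteq> {} \<Longrightarrow> \<exists>h\<in>reduced G. h i = 0"
  using lower_attained[of G i] by (force simp: reduced_def)

lemma lower_reduced: "G \<noteq> {} \<Longrightarrow> lower (reduced G) = (\<lambda>_. 0)"
  using reduced_attains_zero[of G] lower_le[of _ "reduced G"] by (metis le_0_eq)

lemma c_inv_eq:
  fixes I :: "('v::finite, 'k::field) mpoly set"
  assumes I: "monomial_ideal I" and G: "G = mins (exps I)" "G \<noteq> {}"
  shows "c_inv I = card {i. \<exists>g\<in>G. lower G i < g i}"
proof -
  have "antichain (reduced G)" unfolding G(1) by (intro antichain_reduced antichain_mins)
  then have "mingens (gcd_free_part I) = mon ` reduced G"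
    unfolding gcd_free_part_eq[OF I G] mingens_eq by (simp add: mins_upset)
  moreover have "(var i :: ('v, 'k) mpoly) dvd mon h \<longleftrightarrow> 0 < h i" for i h
    unfolding var_eq_mon mon_dvd_iff by (auto simp: le_fun_def Suc_le_eq)
  ultimately show ?thesis by (simp add: c_inv_def supp_def reduced_def)
qed

lemma socle_reduced:
  assumes "a \<in> socle (upset (reduced G))"
  shows "(\<lambda>i. a i + lower G i) \<in> socle (upset G)"
proof -
  have *: "(\<lambda>i. b i + lower G i) \<in> upset G \<longleftrightarrow> b \<in> upset (reduced G)" for b
    using upset_reduced[of G] by blast
  have "(\<lambda>i. a i + lower G i)(j := Suc (a j + lower G j)) = (\<lambda>i. (a(j := Suc (a j))) i + lower G i)" for j
    by auto
  then show ?thesis using assms by (simp add: socle_def * del: fun_upd_apply)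
qed

text \<open>To divide a socle element by the gcd, it must be a multiple of it. At each
  \<open>i\<close> this follows from the generator attached to another variable, here
  \<open>i + 1\<close>, whose exponent at \<open>i\<close> is at most \<open>a i\<close>. With one
  variable only the equivalence fails: a proper principal ideal then has a socle element, while its
  quotient by the gcd is the whole ring.\<close>

lemma socle_reduced_iff:
  fixes G :: "(3 \<Rightarrow> nat) set"
  shows "socle (upset (reduced G)) = {} \<longleftrightarrow> socle (upset G) = {}"
proof
  assume "socle (upset (reduced G)) = {}"
  have False if a: "a \<in> socle (upset G)" for a
  proof -
    obtain u where u: "\<And>i. u i \<in> G" "\<And>i. u i i = Suc (a i)" "\<And>i j. j \<noteq> i \<Longrightarrow> u i j \<le> a j"
      by (rule socle_generators[OF a]) blast
    have low: "lower G i \<le> a i" for i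
    proof -
      have "i \<noteq> i + 1" by simp
      then have "u (i + 1) i \<le> a i" by (intro u(3))
      then show ?thesis using lower_le[OF u(1), of i] by (rule order_trans[rotated])
    qed
    define b where "b i = a i - lower G i" for i
    have *: "(\<lambda>i. c i + lower G i) \<in> upset G \<longleftrightarrow> c \<in> upset (reduced G)" for c
      using upset_reduced[of G] by blast
    have "(\<lambda>i. b i + lower G i) = a" using low by (auto simp: b_def)
    moreover have "(\<lambda>i. (b(j := Suc (b j))) i + lower G i) = a(j := Suc (a j))" for j
      using low by (auto simp: b_def)
    ultimately have "b \<in> socle (upset (reduced G))"
      using a by (simp add: socle_def *[symmetric] del: fun_upd_apply)
    then show False using \<open>socle (upset (reduced G)) = {}\<close> by blast
  qed
  then show "socle (upset G) = {}" by blast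
qed (use socle_reduced in blast)

section \<open>Radicals of monomial ideals\<close>

text \<open>The exponent vector of the squarefree part of a monomial.\<close>

definition shadow :: "('v \<Rightarrow> nat) \<Rightarrow> 'v \<Rightarrow> nat" where
  "shadow h i = min 1 (h i)"

text \<open>For sums, each term of the binomial expansion of \<open>(f + g) ^ (m + n)\<close>
  contains \<open>f\<close> at least \<open>m\<close> times or \<open>g\<close> at least
  \<open>n\<close> times.\<close>

lemma radical_closed:
  fixes J :: "'a::comm_ring_1 set"
  assumes J: "module.subspace (*) J"
  shows "module.subspace (*) (radical J)"
proof -
  interpret module "(*) :: 'a \<Rightarrow> _" by (rule module_times)
  have mult: "c * f \<in> J" if "f \<in> J" for c f using subspace_scale[OF J that] .
  show ?thesis
  proof (rule subspaceI)
    show "0 \<in> radical J" using subspace_0[OF J] by (auto simp: radical_def intro!: exI[of _ 1])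
  next
    fix f g assume "f \<in> radical J" "g \<in> radical J"
    then obtain m n where mn: "m \<ge> 1" "f ^ m \<in> J" "g ^ n \<in> J" by (auto simp: radical_def)
    have "of_nat (m + n choose k) * f ^ k * g ^ (m + n - k) \<in> J" for k
    proof (cases "m \<le> k")
      case True
      then have e: "f ^ k = f ^ (k - m) * f ^ m" by (simp flip: power_add)
      have "of_nat (m + n choose k) * f ^ k * g ^ (m + n - k) =
            (of_nat (m + n choose k) * f ^ (k - m) * g ^ (m + n - k)) * f ^ m"
        unfolding e by (simp only: mult_ac)
      then show ?thesis using mult[OF mn(2)] by simp
    next
      case False
      then have e: "g ^ (m + n - k) = g ^ (m - k) * g ^ n" by (simp flip: power_add)
      have "of_nat (m + n choose k) * f ^ k * g ^ (m + n - k) =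
            (of_nat (m + n choose k) * f ^ k * g ^ (m - k)) * g ^ n"
        unfolding e by (simp only: mult_ac)
      then show ?thesis using mult[OF mn(3)] by simp
    qed
    then have "(f + g) ^ (m + n) \<in> J" unfolding binomial_ring by (intro subspace_sum[OF J])
    then show "f + g \<in> radical J" using mn(1) unfolding radical_def by (auto intro!: exI[of _ "m + n"])
  next
    fix c f assume "f \<in> radical J"
    then show "c * f \<in> radical J"
      unfolding radical_def using mult by (auto simp: power_mult_distrib)
  qed
qed

text \<open>The ideal generated by the variables in \<open>T\<close> is prime: modulo it, \<open>f\<close> becomes its part not
  involving these variables, and the polynomial ring has no zero divisors.\<close>

lemma power_in_prime_monomial_ideal:
  fixes f :: "('v::{finite, linorder}, 'k::field) mpoly"
  assumes "f ^ n \<in> polys_on {b. \<exists>i\<in>T. 0 < b i}"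
  shows "f \<in> polys_on {b. \<exists>i\<in>T. 0 < b i}"
proof -
  interpret module "(*) :: ('v, 'k) mpoly \<Rightarrow> _" by (rule module_times)
  define Q where "Q = {b. \<exists>i\<in>T. 0 < (b :: 'v \<Rightarrow> nat) i}"
  have mult: "g * h \<in> polys_on Q" if "h \<in> polys_on Q" for g h :: "('v, 'k) mpoly"
    by (rule polys_on_mult[OF _ that, of _ UNIV]) (auto simp: polys_on_def Q_def)
  have mult': "g * h \<in> polys_on (- Q)" if "g \<in> polys_on (- Q)" "h \<in> polys_on (- Q)" for g h :: "('v, 'k) mpoly"
    by (rule polys_on_mult[OF that]) (auto simp: Q_def)
  have "internal_direct_sum UNIV (\<lambda>b. polys_on (if b then Q else - Q))
     (polys_on (\<Union>b\<in>UNIV. if b then Q else - Q) :: ('v, 'k) mpoly set)"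
    by (intro direct_sum_polys_on) auto
  moreover have "f \<in> polys_on (\<Union>b\<in>UNIV. if b then Q else - Q)" by (auto simp: polys_on_def UNIV_bool)
  ultimately obtain g :: "bool \<Rightarrow> ('v, 'k) mpoly"
    where g: "f = (\<Sum>b\<in>UNIV. g b)" "\<forall>b. g b \<in> polys_on (if b then Q else - Q)"
    unfolding internal_direct_sum_def by auto
  define f1 f0 where "f1 = g True" and "f0 = g False"
  have f: "f = f0 + f1" "f1 \<in> polys_on Q" "f0 \<in> polys_on (- Q)"
    using g by (auto simp: UNIV_bool f1_def f0_def) metis+
  have zero: "(0 :: ('v, 'k) mpoly) \<in> polys_on X" for X by (simp add: polys_on_def)
  have "f ^ m - f0 ^ m \<in> polys_on Q" for m
  proof (induction m)
    case (Suc m)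
    have "f ^ Suc m - f0 ^ Suc m = f * (f ^ m - f0 ^ m) + f0 ^ m * f1"
      by (simp add: f(1) algebra_simps)
    then show ?case using mult Suc f(2) by (simp add: polys_on_add)
  qed (simp add: zero)
  \<comment> \<open>Both \<open>f ^ n\<close> and its difference to \<open>f0 ^ n\<close> lie in the
    ideal, hence so does \<open>f0 ^ n\<close>. For positive \<open>n\<close> its terms involve no
    variable of \<open>T\<close>, so it vanishes; for \<open>n = 0\<close> the hypothesis puts 1
    into the ideal.\<close>
  then have "f ^ n + (- 1) * (f ^ n - f0 ^ n) \<in> polys_on Q"
    using assms by (intro polys_on_add mult) (simp_all add: Q_def)
  then have "f0 ^ n \<in> polys_on Q" by simp
  moreover have "f0 ^ m \<in> polys_on (- Q)" if "m \<ge> 1" for m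
    using that by (induction m rule: dec_induct) (use f(3) mult' in auto)
  ultimately have "n \<ge> 1 \<Longrightarrow> f0 ^ n = 0"
    using keys_eq_empty[of "f0 ^ n"] by (auto simp: polys_on_def)
  moreover have "n = 0 \<Longrightarrow> f \<in> polys_on Q"
    using mult[of 1 f] assms by (auto simp: Q_def)
  ultimately show ?thesis
    using f by (cases n) (auto simp: Q_def)
qed

text \<open>Suppose an exponent \<open>b\<close> of \<open>f\<close> is above no shadow. Then every
  generator involves a variable absent from \<open>b\<close>, so the prime ideal of these absent
  variables contains the given ideal and therefore \<open>f\<close>, but it does not contain the
  monomial of \<open>b\<close>.\<close>

lemma radical_monomial_ideal:
  "radical (polys_on (upset H)) = (polys_on (upset (shadow ` H)) :: ('v::{finite, linorder}, 'k::field) mpoly set)"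
proof
  interpret module "(*) :: ('v, 'k) mpoly \<Rightarrow> _" by (rule module_times)
  have sub: "subspace (polys_on (upset H) :: ('v, 'k) mpoly set)"
    unfolding ideal_gen_mon[symmetric] by simp
  have "mon (shadow h) \<in> (radical (polys_on (upset H)) :: ('v, 'k) mpoly set)" if "h \<in> H" for h
  proof -
    \<comment> \<open>At least as large as each exponent of \<open>h\<close>, and positive, since
      \<open>radical\<close> asks for a positive power.\<close>
    define N where "N = Suc (sum h UNIV)"
    have "h i \<le> N * shadow h i" for i
      using member_le_sum[of i UNIV h] by (cases "h i = 0") (auto simp: N_def shadow_def)
    then have "(\<lambda>i. N * shadow h i) \<in> upset H"
      using that by (auto simp: upset_def le_fun_def)
    then have "mon (shadow h) ^ N \<in> (polys_on (upset H) :: ('v, 'k) mpoly set)"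
      by (simp add: mon_power)
    then show ?thesis unfolding radical_def N_def by (auto simp del: power_Suc)
  qed
  then show "polys_on (upset (shadow ` H)) \<subseteq> (radical (polys_on (upset H)) :: ('v, 'k) mpoly set)"
    unfolding ideal_gen_mon[symmetric]
    by (intro span_minimal radical_closed) (auto simp: ideal_gen_mon sub)
  show "radical (polys_on (upset H)) \<subseteq> (polys_on (upset (shadow ` H)) :: ('v, 'k) mpoly set)"
  proof
    fix f :: "('v, 'k) mpoly" assume "f \<in> radical (polys_on (upset H))"
    then obtain n where n: "f ^ n \<in> polys_on (upset H)" by (auto simp: radical_def)
    have "b \<in> upset (shadow ` H)" if b: "b \<in> Poly_Mapping.lookup ` Poly_Mapping.keys f" for b
    proof (rule ccontr)
      assume nb: "b \<notin> upset (shadow ` H)"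
      have "\<exists>i\<in>{i. b i = 0}. 0 < h i" if "h \<in> H" for h
      proof -
        have "\<not> shadow h \<le> b" using nb that by (auto simp: upset_def)
        then obtain i where "b i < shadow h i" by (auto simp: le_fun_def not_le)
        then show ?thesis by (intro bexI[of _ i]) (auto simp: shadow_def)
      qed
      then have "upset H \<subseteq> {a. \<exists>i\<in>{i. b i = 0}. 0 < a i}"
        by (fastforce simp: upset_def le_fun_def intro: less_le_trans)
      then have "f ^ n \<in> polys_on {a. \<exists>i\<in>{i. b i = 0}. 0 < a i}"
        using n polys_on_mono by blast
      then have "f \<in> polys_on {a. \<exists>i\<in>{i. b i = 0}. 0 < a i}"
        by (rule power_in_prime_monomial_ideal)
      then show False using b by (auto simp: polys_on_def)
    qed
    then show "f \<in> polys_on (upset (shadow ` H))" by (auto simp: polys_on_def)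
  qed
qed

section \<open>Three variables\<close>

lemma three_cases: "(x :: 3) = 1 \<or> x = 2 \<or> x = 3"
proof (induct x)
  case (of_int z)
  then have "z = 0 \<or> z = 1 \<or> z = 2" by auto
  then show ?case by auto
qed

lemma UNIV_three: "(UNIV :: 3 set) = {1, 2, 3}"
  using three_cases by blast

lemma distinct_UNIV_three:
  assumes "(i :: 3) \<noteq> j" "i \<noteq> k" "j \<noteq> k"
  shows "UNIV = {i, j, k}"
proof (rule sym, rule card_subset_eq)
  show "card {i, j, k} = card (UNIV :: 3 set)" using assms by simp
qed auto

lemma ex_third: "\<exists>k :: 3. k \<noteq> i \<and> k \<noteq> j"
proof (rule ccontr)
  assume "\<nexists>k :: 3. k \<noteq> i \<and> k \<noteq> j"
  then have "UNIV \<subseteq> {i, j}" by blast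
  then have "card (UNIV :: 3 set) \<le> card {i, j}" by (intro card_mono) auto
  also have "\<dots> \<le> 2" by (simp add: card_insert_if)
  finally show False by simp
qed

lemma ex_permutation_three:
  assumes "(i :: 3) \<noteq> j" "i \<noteq> k" "j \<noteq> k"
  shows "\<exists>\<pi> :: 3 \<Rightarrow> 3. bij \<pi> \<and> \<pi> 1 = i \<and> \<pi> 2 = j \<and> \<pi> 3 = k"
proof -
  define \<pi> :: "3 \<Rightarrow> 3" where "\<pi> x = (if x = 1 then i else if x = 2 then j else k)" for x
  have \<pi>: "\<pi> 1 = i" "\<pi> 2 = j" "\<pi> 3 = k" by (simp_all add: \<pi>_def)
  have "range \<pi> = {\<pi> 1, \<pi> 2, \<pi> 3}" unfolding UNIV_three by blast
  then have "surj \<pi>" using distinct_UNIV_three[OF assms] by (simp add: \<pi>)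
  then have "bij \<pi>" by (simp add: finite_UNIV_surj_inj bij_def)
  then show ?thesis using \<pi> by blast
qed

text \<open>Exponents relative to an ordering of the three variables that begins with
  \<open>i\<close>, \<open>j\<close>; the third index is the remaining one and is left
  implicit.\<close>

definition vec :: "3 \<Rightarrow> 3 \<Rightarrow> nat \<Rightarrow> nat \<Rightarrow> nat \<Rightarrow> 3 \<Rightarrow> nat" where
  "vec i j a b c l = (if l = i then a else if l = j then b else c)"

lemma vec_eqI:
  assumes "i \<noteq> j" "i \<noteq> k" "j \<noteq> k" "h i = a" "h j = b" "h k = c"
  shows "h = vec i j a b c"
proof
  fix l show "h l = vec i j a b c l"
    using distinct_UNIV_three[OF assms(1-3)] assms(4-6) by (auto simp: vec_def)
qed

lemma vec_le_iff:
  assumes "i \<noteq> j" "i \<noteq> k" "j \<noteq> k"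
  shows "vec i j a b c \<le> vec i j a' b' c' \<longleftrightarrow> a \<le> a' \<and> b \<le> b' \<and> c \<le> c'"
proof -
  have "(\<forall>l. vec i j a b c l \<le> vec i j a' b' c' l) \<longleftrightarrow> (\<forall>l\<in>{i, j, k}. vec i j a b c l \<le> vec i j a' b' c' l)"
    using distinct_UNIV_three[OF assms] by auto
  then show ?thesis using assms by (auto simp: le_fun_def vec_def)
qed

lemma shadow_vec: "shadow (vec i j a b c) = vec i j (min 1 a) (min 1 b) (min 1 c)"
  by (auto simp: shadow_def vec_def)

lemma mon_vec:
  assumes "i \<noteq> j" "i \<noteq> k" "j \<noteq> k"
  shows "(mon (vec i j a b c) :: (3, 'k::field) mpoly) = var i ^ a * var j ^ b * var k ^ c"
  unfolding var_power_eq_mon mon_mult mon_eq_iff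
  by (rule sym, rule vec_eqI[OF assms]) (use assms in auto)

text \<open>The cases count the variables with a pure power in \<open>H\<close>: at least two,
  exactly one, or none. By \<open>zero\<close> each variable is missing from some member, and such a
  member involves both other variables unless it is a pure power.\<close>

lemma antichain_three_cases:
  fixes H :: "(3 \<Rightarrow> nat) set"
  assumes H: "antichain H" "card H = 3" and zero: "\<And>i. \<exists>h\<in>H. h i = 0"
  shows "\<exists>i j k. i \<noteq> j \<and> i \<noteq> k \<and> j \<noteq> k \<and>
    ((\<exists>m n. vec i j m 0 0 \<in> H \<and> vec i j 0 n 0 \<in> H) \<or>
     (\<exists>a1 a2 b1 b2 c1 c2. H = {vec i j a1 0 0, vec i j 0 b1 c1, vec i j a2 b2 c2} \<and>
        0 < a1 \<and> 0 < b1 \<and> 0 < c1 \<and> (0 < a2 \<or> 0 < b2 \<and> 0 < c2)) \<or>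
     (\<exists>a1 a2 b1 b2 c1 c2. H = {vec i j a1 b1 0, vec i j a2 0 c1, vec i j 0 b2 c2} \<and>
        0 < a1 \<and> 0 < a2 \<and> 0 < b1 \<and> 0 < b2 \<and> 0 < c1 \<and> 0 < c2))"
proof -
  have fin: "finite H" using H(2) by (intro card_ge_0_finite) simp
  have third: "\<exists>h. H = {x, y, h}" if "x \<in> H" "y \<in> H" "x \<noteq> y" for x y
  proof -
    have "card (H - {x, y}) = 1" using that H(2) fin by (simp add: card_Diff_subset)
    then obtain h where "H - {x, y} = {h}" by (auto simp: card_1_singleton_iff)
    then show ?thesis using that by blast
  qed
  have nonzero: "h \<noteq> (\<lambda>_. 0)" if h: "h \<in> H" for h
  proof
    assume "h = (\<lambda>_. 0)"
    then have "h \<le> g" for g by (simp add: le_fun_def)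
    then have "h = g" if "g \<in> H" for g using H(1) h that unfolding antichain_def by blast
    then have "H = {h}" using h by blast
    then show False using H(2) by simp
  qed
  define pure where "pure i \<longleftrightarrow> (\<exists>h\<in>H. \<forall>j. j \<noteq> i \<longrightarrow> h j = 0)" for i
  have pos: "0 < h j" if "h \<in> H" "h i = 0" "\<not> pure k" "i \<noteq> j" "i \<noteq> k" "j \<noteq> k" for h i j k
  proof (rule ccontr)
    assume "\<not> 0 < h j"
    then have "\<forall>l. l \<noteq> k \<longrightarrow> h l = 0"
      using that distinct_UNIV_three[OF that(4-6)] by auto
    then show False using that(1,3) by (auto simp: pure_def)
  qed
  consider i j where "pure i" "pure j" "i \<noteq> j" | i where "pure i" "\<And>j. pure j \<Longrightarrow> j = i" | "\<And>i. \<not> pure i"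
    by blast
  then show ?thesis
  proof cases
    case 1
    obtain k where k: "k \<noteq> i" "k \<noteq> j" using ex_third by blast
    obtain g h where gh: "g \<in> H" "\<forall>l. l \<noteq> i \<longrightarrow> g l = 0" "h \<in> H" "\<forall>l. l \<noteq> j \<longrightarrow> h l = 0"
      using 1 by (auto simp: pure_def)
    have "vec i j (g i) 0 0 = g" "vec i j 0 (h j) 0 = h"
      using gh 1(3) k by (intro vec_eqI[of i j k, symmetric]; simp)+
    then have "vec i j (g i) 0 0 \<in> H \<and> vec i j 0 (h j) 0 \<in> H" using gh(1,3) by simp
    then have alt: "\<exists>m n. vec i j m 0 0 \<in> H \<and> vec i j 0 n 0 \<in> H" by (intro exI)
    have dist: "i \<noteq> j" "i \<noteq> k" "j \<noteq> k" using 1(3) k by auto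
    show ?thesis
      by (rule exI[of _ i], rule exI[of _ j], rule exI[of _ k], intro conjI dist, rule disjI1, rule alt)
  next
    case 2
    obtain j where j: "j \<noteq> i" using ex_third by blast
    obtain k where k: "k \<noteq> i" "k \<noteq> j" using ex_third by blast
    have dist: "i \<noteq> j" "i \<noteq> k" "j \<noteq> k" using j k by auto
    have np: "\<not> pure j" "\<not> pure k" using 2(2) j k by blast+
    obtain g where g: "g \<in> H" "\<forall>l. l \<noteq> i \<longrightarrow> g l = 0" using 2(1) by (auto simp: pure_def)
    obtain h where h: "h \<in> H" "h i = 0" using zero by blast
    have "0 < g i" using nonzero[OF g(1)] g(2) by (metis ext gr0I)
    then have "g \<noteq> h" using h(2) by auto
    then obtain q where q: "H = {g, h, q}" using third[OF g(1) h(1)] by blast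
    \<comment> \<open>If the third generator does not involve \<open>i\<close>, then, like
      \<open>h\<close>, it involves both \<open>j\<close> and \<open>k\<close>, because neither of
      these has a pure power.\<close>
    have q': "0 < q i \<or> 0 < q j \<and> 0 < q k"
      using pos[of q i j k] pos[of q i k j] np dist q by auto
    have "0 < h j" "0 < h k" using pos[OF h, of k j] pos[OF h, of j k] np dist by auto
    moreover have "H = {vec i j (g i) 0 0, vec i j 0 (h j) (h k), vec i j (q i) (q j) (q k)}"
    proof -
      have "vec i j (g i) 0 0 = g" "vec i j 0 (h j) (h k) = h" "vec i j (q i) (q j) (q k) = q"
        using g(2) h(2) dist by (intro vec_eqI[OF dist, symmetric]; simp)+
      then show ?thesis using q by simp
    qed
    ultimately have alt: "\<exists>a1 a2 b1 b2 c1 c2. H = {vec i j a1 0 0, vec i j 0 b1 c1, vec i j a2 b2 c2} \<and>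
        0 < a1 \<and> 0 < b1 \<and> 0 < c1 \<and> (0 < a2 \<or> 0 < b2 \<and> 0 < c2)"
      using q' \<open>0 < g i\<close> by blast
    show ?thesis
      by (rule exI[of _ i], rule exI[of _ j], rule exI[of _ k], intro conjI dist, rule disjI2, rule disjI1, rule alt)
  next
    case 3
    have dist: "(1 :: 3) \<noteq> 2" "(1 :: 3) \<noteq> 3" "(2 :: 3) \<noteq> 3" by simp_all
    \<comment> \<open>One member missing each variable. Each involves the two other variables, so
      the three are distinct and exhaust \<open>H\<close>.\<close>
    obtain p q r where pqr: "p \<in> H" "p 1 = 0" "q \<in> H" "q 2 = 0" "r \<in> H" "r 3 = 0"
      using zero by meson
    have p: "0 < p 2" "0 < p 3" and q: "0 < q 1" "0 < q 3" and r: "0 < r 1" "0 < r 2"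
      using pos[OF pqr(1,2), of 3 2] pos[OF pqr(1,2), of 2 3] pos[OF pqr(3,4), of 1 3]
        pos[OF pqr(3,4), of 3 1] pos[OF pqr(5,6), of 1 2] pos[OF pqr(5,6), of 2 1] 3 dist by auto
    have ne: "r \<noteq> q" "r \<noteq> p" "q \<noteq> p" using pqr p q r by auto
    obtain s where "H = {r, q, s}" using third[OF pqr(5,3) ne(1)] by blast
    then have "H = {r, q, p}" using pqr(1) ne by auto
    moreover have "vec 1 2 (r 1) (r 2) 0 = r" "vec 1 2 (q 1) 0 (q 3) = q" "vec 1 2 0 (p 2) (p 3) = p"
      using pqr by (intro vec_eqI[OF dist, symmetric]; simp)+
    ultimately have "H = {vec 1 2 (r 1) (r 2) 0, vec 1 2 (q 1) 0 (q 3), vec 1 2 0 (p 2) (p 3)}"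
      by simp
    then have alt: "\<exists>a1 a2 b1 b2 c1 c2. H = {vec 1 2 a1 b1 0, vec 1 2 a2 0 c1, vec 1 2 0 b2 c2} \<and>
        0 < a1 \<and> 0 < a2 \<and> 0 < b1 \<and> 0 < b2 \<and> 0 < c1 \<and> 0 < c2"
      using p q r by blast
    show ?thesis
      by (rule exI[of _ 1], rule exI[of _ 2], rule exI[of _ 3], intro conjI dist, rule disjI2, rule disjI2, rule alt)
  qed
qed

section \<open>Radical and generators in the three cases\<close>

lemma upset_subsetI: "(\<And>g. g \<in> G \<Longrightarrow> \<exists>h\<in>H. h \<le> g) \<Longrightarrow> upset G \<subseteq> upset H"
  unfolding upset_def by (blast intro: order_trans)

lemma three_generators_classification:
  fixes H :: "(3 \<Rightarrow> nat) set"
  assumes H: "antichain H" "card H = 3" and zero: "\<And>i. \<exists>h\<in>H. h i = 0"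
    and J: "J = (polys_on (upset H) :: (3, 'k::field) mpoly set)"
  shows "\<exists>\<pi> :: 3 \<Rightarrow> 3. bij \<pi> \<and>
            (let x1 = var (\<pi> 1); x2 = var (\<pi> 2); x3 = var (\<pi> 3) in
               ideal_gen {x1, x2} \<subseteq> radical J \<or>
               (radical J = ideal_gen {x1, x2 * x3} \<and>
                 (\<exists>a1 a2 b1 b2 c1 c2 :: nat.
                    J = ideal_gen {x1 ^ a1, x2 ^ b1 * x3 ^ c1, x1 ^ a2 * x2 ^ b2 * x3 ^ c2})) \<or>
               (radical J = ideal_gen {x1 * x2, x1 * x3, x2 * x3} \<and>
                 (\<exists>a1 a2 b1 b2 c1 c2 :: nat.
                    a1 > 0 \<and> a2 > 0 \<and> b1 > 0 \<and> b2 > 0 \<and> c1 > 0 \<and> c2 > 0 \<and>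
                    J = ideal_gen {x1 ^ a1 * x2 ^ b1, x1 ^ a2 * x3 ^ c1, x2 ^ b2 * x3 ^ c2})))"
proof -
  obtain i j k where dist: "i \<noteq> j" "i \<noteq> k" "j \<noteq> k" and alt:
    "(\<exists>m n. vec i j m 0 0 \<in> H \<and> vec i j 0 n 0 \<in> H) \<or>
     (\<exists>a1 a2 b1 b2 c1 c2. H = {vec i j a1 0 0, vec i j 0 b1 c1, vec i j a2 b2 c2} \<and>
        0 < a1 \<and> 0 < b1 \<and> 0 < c1 \<and> (0 < a2 \<or> 0 < b2 \<and> 0 < c2)) \<or>
     (\<exists>a1 a2 b1 b2 c1 c2. H = {vec i j a1 b1 0, vec i j a2 0 c1, vec i j 0 b2 c2} \<and>
        0 < a1 \<and> 0 < a2 \<and> 0 < b1 \<and> 0 < b2 \<and> 0 < c1 \<and> 0 < c2)"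
    using antichain_three_cases[OF H zero] by (elim exE conjE) (rule that)
  obtain \<pi> :: "3 \<Rightarrow> 3" where \<pi>: "bij \<pi>" "\<pi> 1 = i" "\<pi> 2 = j" "\<pi> 3 = k"
    using ex_permutation_three[OF dist] by blast
  note le = vec_le_iff[OF dist]
  have rad: "radical J = polys_on (upset (shadow ` H))"
    unfolding J by (rule radical_monomial_ideal)
  have mon: "mon (vec i j a b c) = (var i ^ a * var j ^ b * var k ^ c :: (3, 'k) mpoly)" for a b c
    by (rule mon_vec[OF dist])
  have gen: "(polys_on (upset G) :: (3, 'k) mpoly set) = ideal_gen (mon ` G)" for G
    by (rule ideal_gen_mon[symmetric])
  from alt have "(let x1 = var i; x2 = var j; x3 = var k in
               ideal_gen {x1, x2} \<subseteq> radical J \<or>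
               (radical J = ideal_gen {x1, x2 * x3} \<and>
                 (\<exists>a1 a2 b1 b2 c1 c2 :: nat.
                    J = ideal_gen {x1 ^ a1, x2 ^ b1 * x3 ^ c1, x1 ^ a2 * x2 ^ b2 * x3 ^ c2})) \<or>
               (radical J = ideal_gen {x1 * x2, x1 * x3, x2 * x3} \<and>
                 (\<exists>a1 a2 b1 b2 c1 c2 :: nat.
                    a1 > 0 \<and> a2 > 0 \<and> b1 > 0 \<and> b2 > 0 \<and> c1 > 0 \<and> c2 > 0 \<and>
                    J = ideal_gen {x1 ^ a1 * x2 ^ b1, x1 ^ a2 * x3 ^ c1, x2 ^ b2 * x3 ^ c2})))"
  proof (elim disjE)
    assume "\<exists>m n. vec i j m 0 0 \<in> H \<and> vec i j 0 n 0 \<in> H"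
    then obtain m n where 1: "vec i j m 0 0 \<in> H" "vec i j 0 n 0 \<in> H" by (elim exE conjE)
    have "upset {vec i j 1 0 0, vec i j 0 1 0} \<subseteq> upset (shadow ` H)"
    proof (rule upset_subsetI)
      fix g assume "g \<in> {vec i j 1 0 0, vec i j 0 1 0}"
      then have "shadow (vec i j m 0 0) \<le> g \<or> shadow (vec i j 0 n 0) \<le> g"
        by (auto simp: shadow_vec le)
      then show "\<exists>h\<in>shadow ` H. h \<le> g" using 1 by blast
    qed
    then have "ideal_gen (mon ` {vec i j 1 0 0, vec i j 0 1 0}) \<subseteq> radical J"
      unfolding rad ideal_gen_mon by (rule polys_on_mono)
    then show ?thesis unfolding Let_def by (simp add: mon)
  next
    assume "\<exists>a1 a2 b1 b2 c1 c2. H = {vec i j a1 0 0, vec i j 0 b1 c1, vec i j a2 b2 c2} \<and>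
        0 < a1 \<and> 0 < b1 \<and> 0 < c1 \<and> (0 < a2 \<or> 0 < b2 \<and> 0 < c2)"
    then obtain a1 a2 b1 b2 c1 c2 where 2: "H = {vec i j a1 0 0, vec i j 0 b1 c1, vec i j a2 b2 c2}"
      "0 < a1" "0 < b1" "0 < c1" "0 < a2 \<or> 0 < b2 \<and> 0 < c2"
      by (elim exE conjE)
    \<comment> \<open>The shadow of the third generator is redundant: by the last condition it is
      divisible by \<open>x_i\<close> or by \<open>x_j x_k\<close>.\<close>
    have "upset (shadow ` H) = upset {vec i j 1 0 0, vec i j 0 1 1}"
      by (intro equalityI upset_subsetI) (use 2(2-5) in \<open>auto simp: 2(1) shadow_vec le\<close>)
    then have rad_J: "radical J = ideal_gen {var i, var j * var k}"
      unfolding rad by (simp add: gen mon)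
    have J_eq: "J = ideal_gen {var i ^ a1, var j ^ b1 * var k ^ c1, var i ^ a2 * var j ^ b2 * var k ^ c2}"
      unfolding J gen 2(1) by (simp add: mon)
    show ?thesis
      unfolding Let_def by (rule disjI2, rule disjI1, rule conjI[OF rad_J], intro exI, rule J_eq)
  next
    assume "\<exists>a1 a2 b1 b2 c1 c2. H = {vec i j a1 b1 0, vec i j a2 0 c1, vec i j 0 b2 c2} \<and>
        0 < a1 \<and> 0 < a2 \<and> 0 < b1 \<and> 0 < b2 \<and> 0 < c1 \<and> 0 < c2"
    then obtain a1 a2 b1 b2 c1 c2 where 3: "H = {vec i j a1 b1 0, vec i j a2 0 c1, vec i j 0 b2 c2}"
      "0 < a1" "0 < a2" "0 < b1" "0 < b2" "0 < c1" "0 < c2"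
      by (elim exE conjE)
    have "upset (shadow ` H) = upset {vec i j 1 1 0, vec i j 1 0 1, vec i j 0 1 1}"
      by (intro equalityI upset_subsetI) (use 3(2-7) in \<open>auto simp: 3(1) shadow_vec le\<close>)
    then have rad_J: "radical J = ideal_gen {var i * var j, var i * var k, var j * var k}"
      unfolding rad by (simp add: gen mon)
    have J_eq: "J = ideal_gen {var i ^ a1 * var j ^ b1, var i ^ a2 * var k ^ c1, var j ^ b2 * var k ^ c2}"
      unfolding J gen 3(1) by (simp add: mon)
    show ?thesis
      unfolding Let_def
      by (rule disjI2, rule disjI2, rule conjI[OF rad_J], rule exI[of _ a1], rule exI[of _ a2],
        rule exI[of _ b1], rule exI[of _ b2], rule exI[of _ c1], rule exI[of _ c2], intro conjI 3(2-7), rule J_eq)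
  qed
  then show ?thesis using \<pi> by (intro exI[of _ \<pi>]) simp
qed

section \<open>Socle elements from the colon ideal and inside few generators\<close>

lemma socle_of_colon:
  fixes I :: "('v::finite, 'k::field) mpoly set"
  assumes I: "monomial_ideal I" and ne: "I \<noteq> colon I (ideal_gen (range var))"
  shows "socle (exps I) \<noteq> {}"
proof -
  interpret module "(*) :: ('v, 'k) mpoly \<Rightarrow> _" by (rule module_times)
  have I_eq: "I = polys_on (exps I)" by (rule monomial_ideal_polys_on[OF I])
  have "subspace I" using I by (auto simp: monomial_ideal_def)
  then have "f * g \<in> I" if "f \<in> I" for f g
    using subspace_scale[of I f g] that by (simp add: mult.commute)
  then have "I \<subseteq> colon I (span (range var))" by (auto simp: colon_def)
  then obtain f where f: "f \<in> colon I (span (range var))" "f \<notin> I" using ne by blast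
  have "f \<notin> polys_on (exps I)" using f(2) I_eq by simp
  \<comment> \<open>A term of \<open>f\<close> outside \<open>I\<close>. As \<open>I\<close> is a
    monomial ideal, \<open>f * var i\<close> can only lie in \<open>I\<close> if each term of
    \<open>f\<close> times \<open>x_i\<close> does, so this exponent is a socle element.\<close>
  then obtain k where k: "k \<in> Poly_Mapping.keys f" "Poly_Mapping.lookup k \<notin> exps I"
    by (auto simp: polys_on_def)
  have "(Poly_Mapping.lookup k)(i := Suc (Poly_Mapping.lookup k i)) \<in> exps I" for i
  proof -
    have "f * var i \<in> I" using f(1) span_base[of "var i" "range var"] by (auto simp: colon_def)
    then have "f * mon (\<lambda>j. if j = i then 1 else 0) \<in> polys_on (exps I)"
      using I_eq by (simp add: var_eq_mon)
    then have "(\<lambda>j. Poly_Mapping.lookup k j + (if j = i then 1 else 0)) \<in> exps I"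
      using k(1) unfolding times_mon_in_polys_on by (auto simp: polys_on_def)
    moreover have "(\<lambda>j. Poly_Mapping.lookup k j + (if j = i then 1 else 0)) =
        (Poly_Mapping.lookup k)(i := Suc (Poly_Mapping.lookup k i))" by auto
    ultimately show ?thesis by simp
  qed
  then show ?thesis using k(2) by (auto simp: socle_def)
qed

text \<open>Passing to fewer generators keeps \<open>a\<close> outside the ideal, and raising
  \<open>a\<close> at \<open>i\<close> still reaches \<open>u i\<close>. In three variables this
  reduces (d) to the ideals \<open>I_\<sigma>\<close>.\<close>

lemma socle_subset_generators:
  fixes G :: "('v::finite \<Rightarrow> nat) set"
  assumes "a \<in> socle (upset G)"
  shows "\<exists>K\<subseteq>G. card K = CARD('v) \<and> a \<in> socle (upset K)"
proof -
  obtain u where u: "\<And>i. u i \<in> G" "\<And>i. u i i = Suc (a i)" "\<And>i j. j \<noteq> i \<Longrightarrow> u i j \<le> a j"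
    by (rule socle_generators[OF assms]) blast
  have "inj u" by (rule injI) (metis u(2,3) Suc_n_not_le_n)
  moreover have "a \<in> socle (upset (range u))"
    unfolding socle_def
  proof (intro CollectI conjI allI)
    show "a \<notin> upset (range u)" using assms u(1) by (auto simp: socle_def upset_def)
    show "a(i := Suc (a i)) \<in> upset (range u)" for i
      unfolding upset_def using u(2,3) by (auto simp: le_fun_def intro!: exI[of _ i])
  qed
  ultimately show ?thesis using u(1) by (intro exI[of _ "range u"]) (auto simp: card_image)
qed

theorem theorem2p3:
  fixes I :: "(3, 'k::field) mpoly set"
  assumes "monomial_ideal I" and "I \<noteq> UNIV"
  shows
   "(num_mingens I = 1 \<longrightarrow> sdepth UNIV I = 2) \<and>
    (num_mingens I = 2 \<longrightarrow> sdepth UNIV I = 1) \<and>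
    (num_mingens I \<ge> 3 \<and> c_inv I = 2 \<longrightarrow> sdepth UNIV I = 1) \<and>
    (num_mingens I = 3 \<and> c_inv I = 3 \<longrightarrow>
       (let I' = gcd_free_part I in
          sdepth UNIV I = sdepth UNIV I' \<and> num_mingens I' = 3 \<and> c_inv I' = 3 \<and>
          (\<exists>\<pi> :: 3 \<Rightarrow> 3. bij \<pi> \<and>
            (let x1 = var (\<pi> 1); x2 = var (\<pi> 2); x3 = var (\<pi> 3) in
               ideal_gen {x1, x2} \<subseteq> radical I' \<or>
               (radical I' = ideal_gen {x1, x2 * x3} \<and>
                 (\<exists>a1 a2 b1 b2 c1 c2 :: nat.
                    I' = ideal_gen {x1 ^ a1, x2 ^ b1 * x3 ^ c1, x1 ^ a2 * x2 ^ b2 * x3 ^ c2})) \<or>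
               (radical I' = ideal_gen {x1 * x2, x1 * x3, x2 * x3} \<and>
                 (\<exists>a1 a2 b1 b2 c1 c2 :: nat.
                    a1 > 0 \<and> a2 > 0 \<and> b1 > 0 \<and> b2 > 0 \<and> c1 > 0 \<and> c2 > 0 \<and>
                    I' = ideal_gen {x1 ^ a1 * x2 ^ b1, x1 ^ a2 * x3 ^ c1, x2 ^ b2 * x3 ^ c2})))))) \<and>
    (\<forall>m (u :: nat \<Rightarrow> (3, 'k) mpoly).
       m = num_mingens I \<and> m > 3 \<and> c_inv I = 3 \<and> bij_betw u {1..m} (mingens I) \<longrightarrow>
         (let all_one = (\<forall>\<sigma>. \<sigma> \<subseteq> {1..m} \<and> card \<sigma> = 3 \<longrightarrow> sdepth UNIV (ideal_gen (u ` \<sigma>)) = 1) in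
            (all_one \<longrightarrow> sdepth UNIV I = 1) \<and>
            (\<not> all_one \<longrightarrow> I \<noteq> colon I (ideal_gen {var 1, var 2, var 3}) \<longrightarrow> sdepth UNIV I = 0)))"
proof (intro conjI impI allI)
  define G where "G = mins (exps I)"
  have E: "exps I = upset G" unfolding G_def by (rule exps_eq_upset_mins[OF assms(1)])
  have anti: "antichain G" unfolding G_def by (rule antichain_mins)
  have num: "num_mingens I = card G" unfolding G_def by (rule num_mingens_eq)
  have fin: "finite G" if "num_mingens I \<ge> 1"
    using that num by (intro card_ge_0_finite) simp
  have I_eq: "I = polys_on (upset G)" using monomial_ideal_polys_on[OF assms(1)] E by simp
  have depth: "sdepth UNIV I = (if socle (upset G) = {} then 1 else 0)" if "num_mingens I \<ge> 2"
    using that num fin by (intro sdepth_eq_if[OF E _ anti]) simp_all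
  {
    assume "num_mingens I = 1"
    then obtain g where "G = {g}" unfolding num by (auto simp: card_1_singleton_iff)
    then show "sdepth UNIV I = 2"
      using sdepth_principal[OF _ zero_notin_exps[OF assms], of g] E by simp
  next
    assume 2: "num_mingens I = 2"
    have "socle (upset G) = {}"
      using card_ge_of_socle[of _ G] 2 num fin by fastforce
    then show "sdepth UNIV I = 1" using depth 2 by simp
  next
    assume b: "3 \<le> num_mingens I \<and> c_inv I = 2"
    then have "G \<noteq> {}" using num by auto
    then have "card {i. \<exists>g\<in>G. lower G i < g i} = 2"
      using b c_inv_eq[OF assms(1) G_def] by simp
    \<comment> \<open>A variable outside the support of \<open>I'\<close> has the same exponent in
      all generators, whereas a socle element \<open>a\<close> needs one generator with exponent
      \<open>a i + 1\<close> at \<open>i\<close> and another with at most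
      \<open>a i\<close>.\<close>
    then have "{i. \<exists>g\<in>G. lower G i < g i} \<noteq> UNIV" by auto
    then obtain i where "\<not> (\<exists>g\<in>G. lower G i < g i)" by blast
    then have i: "g i \<le> lower G i" if "g \<in> G" for g using that by (auto simp: not_less)
    have "a \<notin> socle (upset G)" for a
    proof
      assume a: "a \<in> socle (upset G)"
      obtain u where u: "\<And>i. u i \<in> G" "\<And>i. u i i = Suc (a i)" "\<And>i j. j \<noteq> i \<Longrightarrow> u i j \<le> a j"
        by (rule socle_generators[OF a]) blast
      have "i \<noteq> i + 1" by simp
      then have "u (i + 1) i \<le> a i" by (rule u(3))
      moreover have "lower G i \<le> u (i + 1) i" by (rule lower_le[OF u(1)])
      ultimately show False using i[OF u(1), of i] u(2)[of i] by simp
    qed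
    then show "sdepth UNIV I = 1" using depth b by auto
  next
    assume c: "num_mingens I = 3 \<and> c_inv I = 3"
    then have ne: "G \<noteq> {}" using num by auto
    define H where "H = reduced G"
    have I': "gcd_free_part I = polys_on (upset H)"
      unfolding H_def by (rule gcd_free_part_eq[OF assms(1) G_def ne])
    have H: "antichain H" "card H = 3" unfolding H_def using antichain_reduced[OF anti] c num by simp_all
    have finH: "finite H" using H(2) by (intro card_ge_0_finite) simp
    have zero: "\<exists>h\<in>H. h i = 0" for i unfolding H_def by (rule reduced_attains_zero[OF ne])
    have mono: "monomial_ideal (gcd_free_part I)" unfolding I' by (rule monomial_ideal_polys_on_upset)
    have mins: "mins (exps (gcd_free_part I)) = H" by (simp add: I' mins_upset H(1))
    have num': "num_mingens (gcd_free_part I) = 3" by (simp add: num_mingens_eq mins H(2))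
    \<comment> \<open>The generators in \<open>H\<close> have gcd 1, so subtracting it changes
      nothing and the same variables are counted for \<open>H\<close> as for
      \<open>G\<close>.\<close>
    have "lower H = (\<lambda>_. 0)" unfolding H_def by (rule lower_reduced[OF ne])
    then have "{i. \<exists>g\<in>H. lower H i < g i} = {i. \<exists>g\<in>G. lower G i < g i}"
      by (auto simp: H_def reduced_def)
    then have c': "c_inv (gcd_free_part I) = 3"
      using c c_inv_eq[OF assms(1) G_def ne] c_inv_eq[OF mono mins[symmetric]] H(2) by force
    have "sdepth UNIV (gcd_free_part I) = (if socle (upset H) = {} then 1 else 0)"
      by (intro sdepth_eq_if finH H) (simp_all add: I' H(2))
    then have "sdepth UNIV I = sdepth UNIV (gcd_free_part I)"
      using depth c by (simp add: H_def socle_reduced_iff)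
    then show "let I' = gcd_free_part I in
          sdepth UNIV I = sdepth UNIV I' \<and> num_mingens I' = 3 \<and> c_inv I' = 3 \<and>
          (\<exists>\<pi> :: 3 \<Rightarrow> 3. bij \<pi> \<and>
            (let x1 = var (\<pi> 1); x2 = var (\<pi> 2); x3 = var (\<pi> 3) in
               ideal_gen {x1, x2} \<subseteq> radical I' \<or>
               (radical I' = ideal_gen {x1, x2 * x3} \<and>
                 (\<exists>a1 a2 b1 b2 c1 c2 :: nat.
                    I' = ideal_gen {x1 ^ a1, x2 ^ b1 * x3 ^ c1, x1 ^ a2 * x2 ^ b2 * x3 ^ c2})) \<or>
               (radical I' = ideal_gen {x1 * x2, x1 * x3, x2 * x3} \<and>
                 (\<exists>a1 a2 b1 b2 c1 c2 :: nat.
                    a1 > 0 \<and> a2 > 0 \<and> b1 > 0 \<and> b2 > 0 \<and> c1 > 0 \<and> c2 > 0 \<and>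
                    I' = ideal_gen {x1 ^ a1 * x2 ^ b1, x1 ^ a2 * x3 ^ c1, x2 ^ b2 * x3 ^ c2}))))"
      unfolding Let_def[of "gcd_free_part I"]
      by (intro conjI num' c' three_generators_classification[OF H zero I'])
  next
    fix m and u :: "nat \<Rightarrow> (3, 'k) mpoly"
    assume d: "m = num_mingens I \<and> m > 3 \<and> c_inv I = 3 \<and> bij_betw u {1..m} (mingens I)"
    have sub: "sdepth UNIV (ideal_gen (mon ` K) :: (3, 'k) mpoly set) = (if socle (upset K) = {} then 1 else 0)"
      if K: "K \<subseteq> G" "card K = 3" for K
    proof (rule sdepth_eq_if[OF exps_ideal_gen])
      show "finite K" using K(2) by (intro card_ge_0_finite) simp
      show "antichain K" using anti K(1) unfolding antichain_def by blast
    qed (simp add: K(2))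
    let ?all = "\<forall>\<sigma>. \<sigma> \<subseteq> {1..m} \<and> card \<sigma> = 3 \<longrightarrow> sdepth UNIV (ideal_gen (u ` \<sigma>)) = 1"
    have "sdepth UNIV I = 1" if all: ?all
    proof -
      have "a \<notin> socle (upset G)" for a
      proof
        assume "a \<in> socle (upset G)"
        from socle_subset_generators[OF this]
        obtain K where K: "K \<subseteq> G" "card K = 3" "a \<in> socle (upset K)" by auto
        \<comment> \<open>The indices of the three generators in \<open>K\<close> under the
          enumeration \<open>u\<close>, to which the assumption on triples is applied.\<close>
        define \<sigma> where "\<sigma> = {x \<in> {1..m}. u x \<in> mon ` K}"
        have u: "inj_on u {1..m}" "u ` {1..m} = mon ` G"
          using d mingens_eq[of I] by (auto simp: bij_betw_def G_def)
        have img: "u ` \<sigma> = mon ` K"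
        proof
          show "mon ` K \<subseteq> u ` \<sigma>"
          proof
            fix w :: "(3, 'k) mpoly" assume w: "w \<in> mon ` K"
            then have "w \<in> u ` {1..m}" using K(1) unfolding u(2) by blast
            then show "w \<in> u ` \<sigma>" using w by (auto simp: \<sigma>_def)
          qed
        qed (auto simp: \<sigma>_def)
        have "inj_on u \<sigma>" using u(1) by (rule inj_on_subset) (auto simp: \<sigma>_def)
        then have "card \<sigma> = card (u ` \<sigma>)" by (simp add: card_image)
        also have "\<dots> = 3" unfolding img using K(2) by (simp add: card_image[OF inj_mon])
        finally have "card \<sigma> = 3" .
        moreover have "\<sigma> \<subseteq> {1..m}" unfolding \<sigma>_def by (rule Collect_restrict)
        ultimately have "sdepth UNIV (ideal_gen (u ` \<sigma>)) = 1" using all by blast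
        then show False unfolding img sub[OF K(1,2)] using K(3) by (auto split: if_splits)
      qed
      then show ?thesis using depth d by auto
    qed
    moreover have "sdepth UNIV I = 0" if "I \<noteq> colon I (ideal_gen {var 1, var 2, var 3})"
    proof -
      have "range var = {var 1, var 2, var 3 :: (3, 'k) mpoly}" by (simp add: UNIV_three)
      then have "socle (upset G) \<noteq> {}" using socle_of_colon[OF assms(1)] that E by simp
      then show ?thesis using depth d by simp
    qed
    ultimately show "let all_one = ?all in
            (all_one \<longrightarrow> sdepth UNIV I = 1) \<and>
            (\<not> all_one \<longrightarrow> I \<noteq> colon I (ideal_gen {var 1, var 2, var 3}) \<longrightarrow> sdepth UNIV I = 0)"
      unfolding Let_def by blast
  }
qed

end
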